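(* (Soft-thresholding with consistent tuning) Suppose that for given $i\ge1$ satisfying $i\le k=k(n)$ for large enough $n$ we have $\xi_{i,n}\eta_{i,n}\to0$ and $n^{1/2}\eta_{i,n}\to\infty$. Set the scaling factor $\alpha_{i,n}=(\xi_{i,n}\eta_{i,n})^{-1}$. Suppose that the true parameters $\theta^{(n)}=(\theta_{1,n},\dots,\theta_{k_n,n})\in\mathbb{R}^{k_n}$ (with $k_n=k(n)$) and $\sigma_n\in(0,\infty)$ satisfy $\theta_{i,n}/(\sigma_n\xi_{i,n}\eta_{i,n})\to\zeta_i\in\bar{\mathbb{R}}$. Let $H_n$ denote the cdf of $\sigma_n^{-1}\alpha_{i,n}(\tilde\theta_{S,i}-\theta_{i,n})$ under $P_{n,\theta^{(n)},\sigma_n}$. (a) If $n-k$ is eventually constant equal to $m$, say, then $H_n$ converges weakly to the distribution given by $$\int_{|\zeta_i|}^\infty\rho_m(s)\,ds\;d\delta_{-\zeta_i}(x)+\left\{\rho_m(x)\mathbf{1}(x+\zeta_i<0)+\rho_m(-x)\mathbf{1}(x+\zeta_i>0)\right\}dx$$ $$=\Pr(\chi_m^2>m\zeta_i^2)\,d\delta_{-\zeta_i}(x)+\left\{\rho_m(x)\mathbf{1}(x+\zeta_i<0)+\rho_m(-x)\mathbf{1}(x+\zeta_i>0)\right\}dx,$$ where $\rho_m(x)=0$ for $x<0$. (In case $|\zeta_i|=\infty$, the atomic part is absent and the expression reduces to $\rho_m(-\mathrm{sign}(\zeta_i)x)\,dx$.) (b) If $n-k\to\infty$, then $H_n$ converges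 weakly to $\delta_{-\mathrm{sign}(\zeta_i)\min(1,|\zeta_i|)}$.
   Context: For each sample size $n$ consider the linear regression model $Y=X\theta+u$, where $X$ is a nonstochastic $n\times k$ matrix of rank $k\ge1$ with $k<n$, $\theta\in\mathbb{R}^k$, $u\sim N(0,\sigma^2I_n)$, $0<\sigma<\infty$. The number $k=k(n)$, the entries of $X,Y,u$ and the underlying probability space may depend on $n$. $P_{n,\theta,\sigma}$ denotes probability under parameters $\theta,\sigma$. $X'$ is the transpose of $X$. $\xi_{i,n}$ is the nonnegative square root of the $i$-th diagonal element of $(X'X/n)^{-1}$. $\hat\theta_{LS}=(X'X)^{-1}X'Y$ with $i$-th component $\hat\theta_{LS,i}$, and $\hat\sigma^2=(n-k)^{-1}(Y-X\hat\theta_{LS})'(Y-X\hat\theta_{LS})$, $\hat\sigma\ge0$. The tuning parameters $\eta_{i,n}$ are positive real numbers. The soft-thresholding estimator is $\tilde\theta_{S,i}=\mathrm{sign}(\hat\theta_{LS,i})(|\hat\theta_{LS,i}|-\hat\sigma\xi_{i,n}\eta_{i,n})_+$ with $(\cdot)_+=\max(\cdot,0)$. Standing assumption for all asymptotics: $\sup_n\xi_{j,n}^2/n<\infty$ for every fixed $j\ge1$ satisfying $j\le k(n)$ for large enough $n$. $\bar{\mathbb{R}}=\mathbb{R}\cup\{-\infty,\infty\}$; $\delta_z$ is pointmass at $z$; if $|\zeta_i|=\infty$ then $x+\zeta_i=\zeta_i$. $\chi_m^2$ denotes a chi-square random variable with $m$ degrees of freedom; $\rho_m$ is the density of $m^{-1/2}$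 times the square root of a $\chi_m^2$ random variable, with $\rho_m(s)=0$ for $s<0$. *)

theory Defs
  imports
    "HOL-Probability.Probability"
    "Jordan_Normal_Form.DL_Rank"
    "Jordan_Normal_Form.Gauss_Jordan_Elimination"
begin

(* The matrix dimensions vary with the sample size, so matrices and vectors are those of
   Jordan_Normal_Form.Matrix, whose indices start at 0: component j + 1 of the regression
   parameter is entry j here. The HOL-Analysis notations that clash are switched off. *)
unbundle no vec_syntax
unbundle no inner_syntax
hide_type (open) Finite_Cartesian_Product.vec
hide_const (open) Finite_Cartesian_Product.vec Finite_Cartesian_Product.mat
  Finite_Cartesian_Product.row Finite_Cartesian_Product.column
  Determinants.det Finite_Cartesian_Product.transpose

(* mat_inverse is the library's option-valued Gauss-Jordan inverse; this is only
   meaningful for invertible matrices. *)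
definition matinv :: "real mat \<Rightarrow> real mat"
  where "matinv A = the (mat_inverse A)"

lemma matinv_unique:
  assumes A: "A \<in> carrier_mat n n" and B: "B \<in> carrier_mat n n"
    and AB: "A * B = 1\<^sub>m n" and BA: "B * A = 1\<^sub>m n"
  shows "matinv A = B"
proof (cases "mat_inverse A")
  case None
  have "A \<in> Units (ring_mat TYPE(real) n ())"
    using A B AB BA by (auto simp: Units_def ring_mat_def)
  with mat_inverse(1)[OF A None, of "()"] show ?thesis by simp
next
  case (Some C)
  from mat_inverse(2)[OF A Some] have C: "C * A = 1\<^sub>m n" "C \<in> carrier_mat n n" by auto
  have "C = C * (A * B)" using AB C by simp
  also have "\<dots> = (C * A) * B" using assoc_mult_mat[OF C(2) A B] by simp
  also have "\<dots> = B" using C B by simp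
  finally show ?thesis using Some by (simp add: matinv_def)
qed

definition mvnormal_density :: "real vec \<Rightarrow> real mat \<Rightarrow> real vec \<Rightarrow> real"
  where "mvnormal_density \<mu> \<Sigma> x =
    exp (- (1 / 2) * ((x - \<mu>) \<bullet> (matinv \<Sigma> *\<^sub>v (x - \<mu>))))
      / sqrt ((2 * pi) ^ dim_vec \<mu> * det \<Sigma>)"

lemma mvnormal_density_spherical:
  assumes "0 < s"
  shows "mvnormal_density (0\<^sub>v n) (s\<^sup>2 \<cdot>\<^sub>m 1\<^sub>m n) (vec n x) = (\<Prod>j<n. normal_density 0 s (x j))"
proof -
  have inv: "matinv (s\<^sup>2 \<cdot>\<^sub>m 1\<^sub>m n) = (1 / s\<^sup>2) \<cdot>\<^sub>m 1\<^sub>m n"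
    using assms by (intro matinv_unique[of _ n]) (auto intro!: eq_matI)
  have dt: "det (s\<^sup>2 \<cdot>\<^sub>m 1\<^sub>m n) = (s\<^sup>2) ^ n" by simp
  have v: "vec n x - 0\<^sub>v n = vec n x" by auto
  have q: "vec n x \<bullet> (((1 / s\<^sup>2) \<cdot>\<^sub>m 1\<^sub>m n) *\<^sub>v vec n x) = (\<Sum>j<n. (x j)\<^sup>2 / s\<^sup>2)"
    by (auto simp: scalar_prod_def power2_eq_square atLeast0LessThan mult_mat_vec_def row_def
        if_distrib[of "\<lambda>z. z * _"] if_distrib[of "\<lambda>z. _ * z"] sum.delta sum.delta'
        cong: if_cong intro!: sum.cong)
  show ?thesis
    unfolding mvnormal_density_def inv dt v q index_zero_vec normal_density_def prod.distrib
    using assms by (simp add: exp_sum[symmetric] sum_divide_distrib sum_distrib_left real_sqrt_mult real_sqrt_power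
        power_mult_distrib power_divide prod_dividef flip: sum_negf)
qed

(* Z ~ N(\<mu>, \<Sigma>) for nonsingular \<Sigma>. Lebesgue measure on R^n is the n-fold product of
   lborel, so a vector is passed to it as the function of its n coordinates. *)
definition mvnormal :: "'w measure \<Rightarrow> ('w \<Rightarrow> real vec) \<Rightarrow> real vec \<Rightarrow> real mat \<Rightarrow> bool"
  where "mvnormal M Z \<mu> \<Sigma> \<longleftrightarrow>
    (\<forall>\<omega>\<in>space M. Z \<omega> \<in> carrier_vec (dim_vec \<mu>)) \<and>
    distributed M (PiM {..<dim_vec \<mu>} (\<lambda>_. lborel))
      (\<lambda>\<omega>. \<lambda>j\<in>{..<dim_vec \<mu>}. Z \<omega> $ j)
      (\<lambda>x. ennreal (mvnormal_density \<mu> \<Sigma> (vec (dim_vec \<mu>) x)))"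

definition xi :: "real mat \<Rightarrow> nat \<Rightarrow> real"
  where "xi X j = sqrt (matinv ((1 / real (dim_row X)) \<cdot>\<^sub>m (X\<^sup>T * X)) $$ (j, j))"

definition theta_LS :: "real mat \<Rightarrow> real vec \<Rightarrow> real vec"
  where "theta_LS X y = (matinv (X\<^sup>T * X) * X\<^sup>T) *\<^sub>v y"

definition sigma_hat :: "real mat \<Rightarrow> real vec \<Rightarrow> real"
  where "sigma_hat X y =
    sqrt ((1 / (real (dim_row X) - real (dim_col X)))
      * ((y - X *\<^sub>v theta_LS X y) \<bullet> (y - X *\<^sub>v theta_LS X y)))"

definition theta_soft :: "real mat \<Rightarrow> real \<Rightarrow> nat \<Rightarrow> real vec \<Rightarrow> real"
  where "theta_soft X \<eta> j y =
    sgn (theta_LS X y $ j) * max (\<bar>theta_LS X y $ j\<bar> - sigma_hat X y * xi X j * \<eta>) 0"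

definition chi_square :: "nat \<Rightarrow> real measure"
  where "chi_square m =
    distr (PiM {..<m} (\<lambda>_. density lborel (\<lambda>x. ennreal (std_normal_density x)))) borel
      (\<lambda>x. \<Sum>j<m. (x j)\<^sup>2)"

(* A Radon-Nikodym derivative is only determined almost everywhere, so the value 0 on the
   negative half-line has to be imposed. *)
definition rho :: "nat \<Rightarrow> real \<Rightarrow> real"
  where "rho m s = (if s < 0 then 0
    else enn2real (RN_deriv lborel
      (distr (chi_square m) borel (\<lambda>x. sqrt x / sqrt (real m))) s))"

(* The measure  w d\<delta>_a(x) + f(x) dx  on the Borel sets of the real line. *)
definition atom_plus_density :: "ennreal \<Rightarrow> real \<Rightarrow> (real \<Rightarrow> real) \<Rightarrow> real measure"
  where "atom_plus_density w a f =
    measure_of UNIV (sets borel)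
      (\<lambda>A. w * indicator A a + (\<integral>\<^sup>+ x \<in> A. ennreal (f x) \<partial>lborel))"

definition soft_ac_part :: "nat \<Rightarrow> ereal \<Rightarrow> real \<Rightarrow> real"
  where "soft_ac_part m \<zeta> x =
    rho m x * of_bool (ereal x + \<zeta> < 0) + rho m (- x) * of_bool (ereal x + \<zeta> > 0)"

(* For infinite \<zeta> the weight of the atom is 0, so that the location assigned to it by
   real_of_ereal is irrelevant. *)
definition soft_limit :: "nat \<Rightarrow> ereal \<Rightarrow> real measure"
  where "soft_limit m \<zeta> =
    atom_plus_density (\<integral>\<^sup>+ s \<in> {s. \<bar>\<zeta>\<bar> \<le> ereal s}. ennreal (rho m s) \<partial>lborel)
      (real_of_ereal (- \<zeta>)) (soft_ac_part m \<zeta>)"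

end

theory Submission
  imports Defs
begin

text \<open>
  Fix the component \<open>i\<close> and put \<open>s = \<sigma> \<xi> \<eta>\<close>, \<open>t = \<theta>\<^sub>i / s\<close>,
  \<open>Z = (theta_LS - \<theta>)\<^sub>i / s\<close> and \<open>R = sigma_hat / \<sigma>\<close>. Soft thresholding is homogeneous, and it subtracts
  from its argument that argument truncated at the threshold. Hence the scaled error is exactly
  \<open>Z + shrink (t + Z) R\<close>, where \<open>shrink \<zeta> r = - sgn \<zeta> \<cdot> min r \<bar>\<zeta>\<bar>\<close>
  (lemma \<open>scaled_error_representation\<close>). The map \<open>shrink\<close> is Lipschitz with constant 1 in \<open>r\<close> and in finite \<open>\<zeta>\<close>,
  \<open>Z\<close> has mean zero and variance \<open>1 / (n \<eta>\<^sup>2)\<close>, which tends to zero, and \<open>t\<close> tends to \<open>\<zeta>\<close>. So the scaled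
  error differs from \<open>shrink \<zeta> R\<close> by a term that vanishes in probability (lemma \<open>close_to_shrink\<close>), and only
  the law of \<open>R\<close> remains; the joint law of \<open>Z\<close> and \<open>R\<close> has no influence because \<open>Z\<close> disappears.

  That law is \<open>chi_law (n - k)\<close>, the law of the root of a chi-square variable divided by its
  degrees of freedom \<open>n - k\<close> (lemma \<open>residual_law\<close>). Rotations in coordinate planes preserve the standard Gaussian
  measure, and a product of them brings the design matrix into triangular form. In the rotated
  coordinates the column space of the design consists of the vectors supported on the first \<open>k\<close>
  coordinates, so the residual vector is formed by the last \<open>n - k\<close> of \<open>n\<close> independent standard normal
  variables.

  If \<open>n - k\<close> is eventually \<open>m\<close>, then \<open>shrink \<zeta> R\<close> has the same law for all large \<open>n\<close>, namely that of
  \<open>shrink \<zeta>\<close> under \<open>chi_law m\<close>. It has an atom at \<open>- \<zeta>\<close>, coming from the event \<open>\<bar>\<zeta>\<bar> \<le> R\<close>, and on the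
  complement it is the law of \<open>- sgn \<zeta> \<cdot> R\<close>; this is the stated mixture
  (lemma \<open>soft_limit_eq_shrink_law\<close>). If \<open>n - k\<close> tends to infinity, then \<open>R\<close> tends to 1 in probability, because
  \<open>R\<^sup>2\<close> has mean 1 and variance \<open>2 / (n - k)\<close>, and the limit is the point \<open>shrink \<zeta> 1\<close>.
\<close>

section \<open>The limiting shrinkage map\<close>

text \<open>
  The displacement that soft thresholding with threshold \<open>r\<close> causes at the point \<open>\<zeta>\<close>. It is defined
  on the extended reals because the limits of the normalized parameters may be infinite; there
  the displacement is the full threshold towards zero.
\<close>

definition shrink :: "ereal \<Rightarrow> real \<Rightarrow> real"
  where "shrink \<zeta> r = real_of_ereal (- sgn \<zeta> * min (ereal r) \<bar>\<zeta>\<bar>)"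

lemma shrink_simps:
  "shrink (ereal z) r = - sgn z * min r \<bar>z\<bar>"
  "shrink \<infinity> r = - r"
  "shrink (- \<infinity>) r = r"
  by (auto simp: shrink_def min_def sgn_if)

lemma shrink_one: "shrink \<zeta> 1 = real_of_ereal (- sgn \<zeta> * min 1 \<bar>\<zeta>\<bar>)"
  by (simp add: shrink_def one_ereal_def)

lemma borel_measurable_shrink [measurable]: "shrink \<zeta> \<in> borel_measurable borel"
  by (cases \<zeta>) (auto simp: shrink_simps[abs_def])

lemma soft_threshold_eq_shrink:
  assumes "0 \<le> r"
  shows "sgn w * max (\<bar>w\<bar> - r) 0 = w + shrink (ereal w) r"
  using assms by (auto simp: shrink_simps sgn_if max_def min_def)

lemma shrink_lipschitz_ereal:
  assumes "0 \<le> r"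
  shows "\<bar>shrink (ereal v) r - shrink (ereal w) r\<bar> \<le> \<bar>v - w\<bar>"
  using assms by (auto simp: shrink_simps sgn_if min_def abs_if split: if_splits)

lemma shrink_lipschitz_real:
  "\<bar>shrink \<zeta> r - shrink \<zeta> s\<bar> \<le> \<bar>r - s\<bar>"
  by (cases \<zeta>) (auto simp: shrink_simps sgn_if min_def abs_if split: if_splits)

text \<open>
  The convergence is uniform on bounded sets of thresholds. For a finite limit this is the Lipschitz bound;
  for an infinite one, both sides are equal once \<open>t n\<close> lies beyond the bound on the side of \<open>\<zeta>\<close>.
\<close>

lemma shrink_eventually:
  fixes t :: "nat \<Rightarrow> real"
  assumes t: "(\<lambda>n. ereal (t n)) \<longlonglongrightarrow> \<zeta>" and e: "0 < e"
  shows "eventually (\<lambda>n. \<forall>r. 0 \<le> r \<and> r \<le> B \<longrightarrow> \<bar>shrink (ereal (t n)) r - shrink \<zeta> r\<bar> < e) sequentially"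
proof (cases \<zeta>)
  case (real z)
  then have "t \<longlonglongrightarrow> z" using t by simp
  then have "eventually (\<lambda>n. \<bar>t n - z\<bar> < e) sequentially"
    using e by (auto simp: tendsto_iff dist_real_def)
  then show ?thesis
    by eventually_elim (auto simp: real intro: le_less_trans[OF shrink_lipschitz_ereal])
next
  case PInf
  then have "eventually (\<lambda>n. ereal (max 0 B) < ereal (t n)) sequentially"
    using t by (intro order_tendstoD(1)) auto
  then show ?thesis
    by eventually_elim (use e in \<open>auto simp: PInf shrink_simps\<close>)
next
  case MInf
  then have "eventually (\<lambda>n. ereal (t n) < ereal (- max 0 B)) sequentially"
    using t by (intro order_tendstoD(2)) auto
  then show ?thesis
    by eventually_elim (use e in \<open>auto simp: MInf shrink_simps\<close>)
qed

section \<open>Standard Gaussian coordinates and tail bounds\<close>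

abbreviation std_normal :: "real measure"
  where "std_normal \<equiv> density lborel (\<lambda>x. ennreal (std_normal_density x))"

definition std_gauss :: "nat \<Rightarrow> (nat \<Rightarrow> real) measure"
  where "std_gauss n = PiM {..<n} (\<lambda>_. std_normal)"

lemma prob_space_std_normal: "prob_space std_normal"
  by (rule prob_space_normal_density) simp

lemma prob_space_std_gauss: "prob_space (std_gauss n)"
  unfolding std_gauss_def by (intro prob_space_PiM prob_space_std_normal)

lemma sets_std_gauss [measurable_cong]: "sets (std_gauss n) = sets (PiM {..<n} (\<lambda>_. borel))"
  unfolding std_gauss_def by (intro sets_PiM_cong) auto

lemma space_std_gauss: "space (std_gauss n) = extensional {..<n}"
  by (simp add: std_gauss_def space_PiM PiE_def)

lemma chi_square_std_gauss: "chi_square m = distr (std_gauss m) borel (\<lambda>x. \<Sum>j<m. (x j)\<^sup>2)"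
  by (simp add: chi_square_def std_gauss_def)

text \<open>
  Centred functions of distinct coordinates are orthogonal in the product space. Both tail bounds
  below are this identity combined with Chebyshev's inequality.
\<close>

lemma second_moment_sum_PiM:
  fixes N :: "'i \<Rightarrow> 'a measure" and g :: "'i \<Rightarrow> 'a \<Rightarrow> real"
  assumes N: "\<And>i. prob_space (N i)" and I: "finite I"
    and g2: "\<And>i. i \<in> I \<Longrightarrow> integrable (N i) (\<lambda>x. (g i x)\<^sup>2)"
    and gm: "\<And>i. i \<in> I \<Longrightarrow> g i \<in> borel_measurable (N i)"
    and g0: "\<And>i. i \<in> I \<Longrightarrow> integral\<^sup>L (N i) (g i) = 0"
  shows "has_bochner_integral (PiM I N) (\<lambda>x. (\<Sum>i\<in>I. g i (x i))\<^sup>2) (\<Sum>i\<in>I. integral\<^sup>L (N i) (\<lambda>x. (g i x)\<^sup>2))"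
proof -
  interpret product_sigma_finite N
    by unfold_locales (use N in \<open>auto simp: prob_space_def finite_measure_def sigma_finite_measure_def\<close>)
  have g1: "integrable (N i) (g i)" if "i \<in> I" for i
  proof -
    interpret prob_space "N i" by (rule N)
    show ?thesis by (rule square_integrable_imp_integrable[OF gm[OF that] g2[OF that]])
  qed
  have cross: "has_bochner_integral (PiM I N) (\<lambda>x. g i (x i) * g j (x j))
      (if i = j then integral\<^sup>L (N i) (\<lambda>x. (g i x)\<^sup>2) else 0)" if ij: "i \<in> I" "j \<in> I" for i j
  proof -
    \<comment> \<open>a single product of functions of the coordinates that covers both \<open>i = j\<close> and \<open>i \<noteq> j\<close>\<close>
    define f where "f l x = (if l = i then g i x else 1) * (if l = j then g j x else 1)" for l x
    have fi: "integrable (N l) (f l)" if "l \<in> I" for l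
    proof -
      interpret prob_space "N l" by (rule N)
      show ?thesis using g1[OF that] g2[OF that]
        by (cases "l = i"; cases "l = j") (auto simp: f_def[abs_def] power2_eq_square)
    qed
    have prod_f: "(\<Prod>l\<in>I. f l (x l)) = g i (x i) * g j (x j)" for x
      using ij I by (simp add: f_def prod.distrib prod.delta)
    have "has_bochner_integral (PiM I N) (\<lambda>x. \<Prod>l\<in>I. f l (x l)) (\<Prod>l\<in>I. integral\<^sup>L (N l) (f l))"
      using product_integrable_prod[OF I fi] product_integral_prod[OF I fi]
      by (simp add: has_bochner_integral_iff)
    moreover have "(\<Prod>l\<in>I. integral\<^sup>L (N l) (f l)) = (if i = j then integral\<^sup>L (N i) (\<lambda>x. (g i x)\<^sup>2) else 0)"
    proof (cases "i = j")
      case True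
      have "integral\<^sup>L (N l) (f l) = (if l = i then integral\<^sup>L (N i) (\<lambda>x. (g i x)\<^sup>2) else 1)" for l
        using prob_space.prob_space[OF N[of l]] by (simp add: f_def[abs_def] True power2_eq_square)
      then show ?thesis using True ij I by (simp add: prod.delta)
    next
      case False
      then have "integral\<^sup>L (N i) (f i) = 0" using g0[OF ij(1)] by (simp add: f_def[abs_def])
      then show ?thesis using False ij I by (auto intro: prod_zero)
    qed
    ultimately show ?thesis by (simp add: prod_f)
  qed
  have "has_bochner_integral (PiM I N) (\<lambda>x. \<Sum>i\<in>I. \<Sum>j\<in>I. g i (x i) * g j (x j))
     (\<Sum>i\<in>I. \<Sum>j\<in>I. if i = j then integral\<^sup>L (N i) (\<lambda>x. (g i x)\<^sup>2) else 0)"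
    by (intro has_bochner_integral_sum cross)
  then show ?thesis
    using I by (simp add: power2_eq_square sum_product sum.delta cong: if_cong)
qed

lemma std_normal_moments:
  "integral\<^sup>L std_normal (\<lambda>x. x) = 0"
  "integrable std_normal (\<lambda>x. x\<^sup>2)" "integral\<^sup>L std_normal (\<lambda>x. x\<^sup>2) = 1"
  "integrable std_normal (\<lambda>x. x ^ 4)" "integral\<^sup>L std_normal (\<lambda>x. x ^ 4) = 3"
proof -
  show "integral\<^sup>L std_normal (\<lambda>x. x) = 0"
    using integral_std_normal_moment_odd[of 0] by (simp add: integral_density)
  show "integrable std_normal (\<lambda>x. x\<^sup>2)"
    using integrable_std_normal_moment[of 2] by (simp add: integrable_density)
  show "integral\<^sup>L std_normal (\<lambda>x. x\<^sup>2) = 1"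
    using integral_std_normal_moment_even[of 1] by (simp add: integral_density)
  show "integrable std_normal (\<lambda>x. x ^ 4)"
    using integrable_std_normal_moment[of 4] by (simp add: integrable_density)
  have "(fact 4 :: real) / (2 ^ 2 * fact 2) = 3" by (simp add: fact_numeral)
  then show "integral\<^sup>L std_normal (\<lambda>x. x ^ 4) = 3"
    using integral_std_normal_moment_even[of 2] by (simp add: integral_density)
qed

lemma linear_form_tail:
  assumes "0 < e"
  shows "measure (std_gauss n) {x \<in> space (std_gauss n). e \<le> \<bar>\<Sum>j<n. a j * x j\<bar>} \<le> (\<Sum>j<n. (a j)\<^sup>2) / e\<^sup>2"
proof -
  interpret prob_space "std_gauss n" by (rule prob_space_std_gauss)
  have *: "has_bochner_integral (std_gauss n) (\<lambda>x. (\<Sum>j<n. a j * x j)\<^sup>2) (\<Sum>j<n. (a j)\<^sup>2)"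
    using second_moment_sum_PiM[of "\<lambda>_. std_normal" "{..<n}" "\<lambda>j x. a j * x", OF prob_space_std_normal]
    by (simp add: power_mult_distrib std_normal_moments std_gauss_def)
  then show ?thesis
    using second_moment_method[of "\<lambda>x. \<Sum>j<n. a j * x j" e] assms
    by (simp add: has_bochner_integral_iff)
qed

text \<open>
  The summands \<open>(x\<^sup>2 - 1) / m\<close> are centred with variance \<open>2 / m\<^sup>2\<close>, since the fourth moment of the standard
  normal distribution is 3.
\<close>

lemma chi_square_tail:
  assumes "0 < e" and m: "0 < m"
  shows "measure (std_gauss m) {x \<in> space (std_gauss m). e \<le> \<bar>(\<Sum>j<m. (x j)\<^sup>2) / m - 1\<bar>} \<le> 2 / (m * e\<^sup>2)"
proof -
  interpret prob_space "std_gauss m" by (rule prob_space_std_gauss)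
  interpret N: prob_space std_normal by (rule prob_space_std_normal)
  have sq: "(x\<^sup>2 - 1)\<^sup>2 = x ^ 4 - 2 * x\<^sup>2 + 1" for x :: real
    by (simp add: power2_eq_square power4_eq_xxxx algebra_simps)
  have sqd: "(x\<^sup>2 / m - 1 / m)\<^sup>2 = (x ^ 4 - 2 * x\<^sup>2 + 1) / m\<^sup>2" for x :: real
    using sq[of x] by (simp add: power_divide flip: diff_divide_distrib)
  have one: "N.prob UNIV = 1" using N.prob_space by simp
  have *: "has_bochner_integral (std_gauss m) (\<lambda>x. (\<Sum>j<m. (x j)\<^sup>2 / m - 1 / m)\<^sup>2) (\<Sum>j<m. 2 / m\<^sup>2)"
    using second_moment_sum_PiM[of "\<lambda>_. std_normal" "{..<m}" "\<lambda>j x. x\<^sup>2 / m - 1 / m", OF prob_space_std_normal] m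
    by (simp add: sqd std_normal_moments std_gauss_def one del: Bochner_Integration.integral_divide)
  have e: "(\<Sum>j<m. (x j)\<^sup>2 / m - 1 / m) = (\<Sum>j<m. (x j)\<^sup>2) / m - 1" for x :: "nat \<Rightarrow> real"
    using m by (simp add: sum_subtractf sum_divide_distrib)
  have "(\<Sum>j<m. 2 / (real m)\<^sup>2) / e\<^sup>2 = 2 / (m * e\<^sup>2)" using m by (simp add: power2_eq_square)
  then show ?thesis
    using second_moment_method[of "\<lambda>x. \<Sum>j<m. (x j)\<^sup>2 / m - 1 / m" e] assms *
    by (simp add: has_bochner_integral_iff e)
qed

section \<open>Rotation invariance of the standard Gaussian measure\<close>

text \<open>
  For \<open>c \<noteq> 0\<close> the rotation is the composition of two maps that each change a single
  coordinate, \<open>a \<mapsto> p = c a + s b\<close> with \<open>b\<close> fixed, and then \<open>b \<mapsto> (b - s p) / c\<close> with \<open>p\<close> fixed. They scale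
  Lebesgue measure on the line by \<open>\<bar>c\<bar>\<close> and \<open>1 / \<bar>c\<bar>\<close>. For \<open>c = 0\<close> the rotation swaps the
  coordinates up to sign.
\<close>

lemma nn_integral_lborel_rotate:
  fixes h :: "real \<times> real \<Rightarrow> ennreal"
  assumes [measurable]: "h \<in> borel_measurable (borel \<Otimes>\<^sub>M borel)" and cs: "c\<^sup>2 + s\<^sup>2 = 1"
  shows "(\<integral>\<^sup>+ b. \<integral>\<^sup>+ a. h (c * a + s * b, c * b - s * a) \<partial>lborel \<partial>lborel) = (\<integral>\<^sup>+ b. \<integral>\<^sup>+ a. h (a, b) \<partial>lborel \<partial>lborel)"
proof (cases "c = 0")
  case False
  have "(\<integral>\<^sup>+ b. \<integral>\<^sup>+ a. h (c * a + s * b, c * b - s * a) \<partial>lborel \<partial>lborel)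
      = (\<integral>\<^sup>+ b. ennreal (1 / \<bar>c\<bar>) * (\<integral>\<^sup>+ p. h (p, (b - s * p) / c) \<partial>lborel) \<partial>lborel)"
  proof (rule nn_integral_cong)
    fix b
    have e: "(b - s * (s * b + c * a)) / c = c * b - s * a" for a
    proof -
      have "c * (c * b - s * a) = (c\<^sup>2 + s\<^sup>2) * b - s * (s * b + c * a)"
        by (simp add: power2_eq_square algebra_simps)
      then show ?thesis using False cs by (simp add: divide_eq_eq mult.commute)
    qed
    have "(\<integral>\<^sup>+ p. h (p, (b - s * p) / c) \<partial>lborel)
        = \<bar>c\<bar> * (\<integral>\<^sup>+ a. h (s * b + c * a, (b - s * (s * b + c * a)) / c) \<partial>lborel)"
      using False by (intro nn_integral_real_affine) auto
    then show "(\<integral>\<^sup>+ a. h (c * a + s * b, c * b - s * a) \<partial>lborel)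
        = ennreal (1 / \<bar>c\<bar>) * (\<integral>\<^sup>+ p. h (p, (b - s * p) / c) \<partial>lborel)"
      using False by (simp add: e mult.assoc[symmetric] ennreal_mult[symmetric] add.commute[of _ "s * b"])
  qed
  also have "\<dots> = ennreal (1 / \<bar>c\<bar>) * (\<integral>\<^sup>+ b. \<integral>\<^sup>+ p. h (p, (b - s * p) / c) \<partial>lborel \<partial>lborel)"
    by (rule nn_integral_cmult) measurable
  also have "(\<integral>\<^sup>+ b. \<integral>\<^sup>+ p. h (p, (b - s * p) / c) \<partial>lborel \<partial>lborel)
      = (\<integral>\<^sup>+ p. \<integral>\<^sup>+ b. h (p, (b - s * p) / c) \<partial>lborel \<partial>lborel)"
    by (rule lborel_pair.Fubini') measurable
  also have "\<dots> = (\<integral>\<^sup>+ p. \<bar>c\<bar> * (\<integral>\<^sup>+ q. h (p, q) \<partial>lborel) \<partial>lborel)"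
  proof (rule nn_integral_cong)
    fix p
    have "(\<integral>\<^sup>+ b. h (p, (b - s * p) / c) \<partial>lborel)
        = \<bar>c\<bar> * (\<integral>\<^sup>+ q. h (p, ((s * p + c * q) - s * p) / c) \<partial>lborel)"
      using False by (intro nn_integral_real_affine) auto
    then show "(\<integral>\<^sup>+ b. h (p, (b - s * p) / c) \<partial>lborel) = \<bar>c\<bar> * (\<integral>\<^sup>+ q. h (p, q) \<partial>lborel)"
      using False by simp
  qed
  also have "\<dots> = \<bar>c\<bar> * (\<integral>\<^sup>+ p. \<integral>\<^sup>+ q. h (p, q) \<partial>lborel \<partial>lborel)"
    by (rule nn_integral_cmult) measurable
  also have "(\<integral>\<^sup>+ p. \<integral>\<^sup>+ q. h (p, q) \<partial>lborel \<partial>lborel) = (\<integral>\<^sup>+ q. \<integral>\<^sup>+ p. h (p, q) \<partial>lborel \<partial>lborel)"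
    by (rule lborel_pair.Fubini') measurable
  finally show ?thesis
    using False by (simp add: mult.assoc[symmetric] ennreal_mult[symmetric])
next
  case True
  then have s: "\<bar>s\<bar> = 1" "s \<noteq> 0" using cs by (auto simp: power2_eq_1_iff)
  have "(\<integral>\<^sup>+ q. \<integral>\<^sup>+ p. h (p, q) \<partial>lborel \<partial>lborel) = (\<integral>\<^sup>+ p. \<integral>\<^sup>+ q. h (p, q) \<partial>lborel \<partial>lborel)"
    by (rule lborel_pair.Fubini') measurable
  also have "\<dots> = \<bar>s\<bar> * (\<integral>\<^sup>+ b. \<integral>\<^sup>+ q. h (0 + s * b, q) \<partial>lborel \<partial>lborel)"
    using s by (intro nn_integral_real_affine) auto
  also have "\<dots> = (\<integral>\<^sup>+ b. \<bar>- s\<bar> * (\<integral>\<^sup>+ a. h (s * b, 0 + (- s) * a) \<partial>lborel) \<partial>lborel)"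
  proof -
    have "(\<integral>\<^sup>+ q. h (s * b, q) \<partial>lborel) = \<bar>- s\<bar> * (\<integral>\<^sup>+ a. h (s * b, 0 + (- s) * a) \<partial>lborel)" for b
      using s by (intro nn_integral_real_affine) auto
    then show ?thesis using s by simp
  qed
  finally show ?thesis using True s by simp
qed

text \<open>
  The joint density depends on \<open>a\<^sup>2 + b\<^sup>2\<close> only, which the rotation preserves.
\<close>

lemma nn_integral_std_normal_rotate:
  fixes g :: "real \<times> real \<Rightarrow> ennreal"
  assumes [measurable]: "g \<in> borel_measurable (borel \<Otimes>\<^sub>M borel)" and cs: "c\<^sup>2 + s\<^sup>2 = 1"
  shows "(\<integral>\<^sup>+ b. \<integral>\<^sup>+ a. g (c * a + s * b, c * b - s * a) \<partial>std_normal \<partial>std_normal) = (\<integral>\<^sup>+ b. \<integral>\<^sup>+ a. g (a, b) \<partial>std_normal \<partial>std_normal)"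
proof -
  define \<phi> where "\<phi> a b = ennreal (std_normal_density b) * ennreal (std_normal_density a)" for a b
  have rot: "\<phi> (c * a + s * b) (c * b - s * a) = \<phi> a b" for a b
  proof -
    have "(c * b - s * a)\<^sup>2 + (c * a + s * b)\<^sup>2 = (c\<^sup>2 + s\<^sup>2) * (b\<^sup>2 + a\<^sup>2)"
      by (simp add: power2_eq_square algebra_simps)
    then have "- (c * b - s * a)\<^sup>2 / 2 + - (c * a + s * b)\<^sup>2 / 2 = - b\<^sup>2 / 2 + - a\<^sup>2 / 2"
      using cs by simp
    then have "exp (- (c * b - s * a)\<^sup>2 / 2) * exp (- (c * a + s * b)\<^sup>2 / 2) = exp (- b\<^sup>2 / 2) * exp (- a\<^sup>2 / 2)"
      by (simp only: exp_add[symmetric])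
    then show ?thesis
      by (simp add: \<phi>_def std_normal_density_def ennreal_mult[symmetric])
  qed
  have dens: "(\<integral>\<^sup>+ b. \<integral>\<^sup>+ a. f (a, b) \<partial>std_normal \<partial>std_normal) = (\<integral>\<^sup>+ b. \<integral>\<^sup>+ a. \<phi> a b * f (a, b) \<partial>lborel \<partial>lborel)"
    if [measurable]: "f \<in> borel_measurable (borel \<Otimes>\<^sub>M borel)" for f :: "real \<times> real \<Rightarrow> ennreal"
  proof -
    have "(\<integral>\<^sup>+ b. \<integral>\<^sup>+ a. f (a, b) \<partial>std_normal \<partial>std_normal)
       = (\<integral>\<^sup>+ b. ennreal (std_normal_density b) * (\<integral>\<^sup>+ a. ennreal (std_normal_density a) * f (a, b) \<partial>lborel) \<partial>lborel)"
      by (simp add: nn_integral_density)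
    also have "\<dots> = (\<integral>\<^sup>+ b. \<integral>\<^sup>+ a. \<phi> a b * f (a, b) \<partial>lborel \<partial>lborel)"
      by (simp add: nn_integral_cmult[symmetric] \<phi>_def mult.assoc)
    finally show ?thesis .
  qed
  have [measurable]: "(\<lambda>x. \<phi> (fst x) (snd x)) \<in> borel_measurable (borel \<Otimes>\<^sub>M borel)"
    unfolding \<phi>_def by measurable
  have "(\<integral>\<^sup>+ b. \<integral>\<^sup>+ a. g (c * a + s * b, c * b - s * a) \<partial>std_normal \<partial>std_normal)
    = (\<integral>\<^sup>+ b. \<integral>\<^sup>+ a. \<phi> a b * g (c * a + s * b, c * b - s * a) \<partial>lborel \<partial>lborel)"
    using dens[of "\<lambda>x. g (c * fst x + s * snd x, c * snd x - s * fst x)"] by simp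
  also have "\<dots> = (\<integral>\<^sup>+ b. \<integral>\<^sup>+ a. \<phi> a b * g (a, b) \<partial>lborel \<partial>lborel)"
    using nn_integral_lborel_rotate[of "\<lambda>x. \<phi> (fst x) (snd x) * g x", OF _ cs] by (simp add: rot)
  finally show ?thesis using dens[of g] by simp
qed

definition plane_rotation :: "nat \<Rightarrow> nat \<Rightarrow> real \<Rightarrow> real \<Rightarrow> (nat \<Rightarrow> real) \<Rightarrow> nat \<Rightarrow> real"
  where "plane_rotation p q c s x = x(p := c * x p + s * x q, q := c * x q - s * x p)"

lemma measurable_plane_rotation [measurable]:
  assumes "p < n" "q < n"
  shows "plane_rotation p q c s \<in> PiM {..<n} (\<lambda>_. borel) \<rightarrow>\<^sub>M PiM {..<n} (\<lambda>_. borel)"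
proof (rule measurable_PiM_single')
  show "(\<lambda>x. plane_rotation p q c s x i) \<in> borel_measurable (PiM {..<n} (\<lambda>_. borel))" if "i \<in> {..<n}" for i
    using assms that by (cases "i = q"; cases "i = p") (simp_all add: plane_rotation_def)
  show "plane_rotation p q c s \<in> space (PiM {..<n} (\<lambda>_. borel)) \<rightarrow> {..<n} \<rightarrow>\<^sub>E space borel"
    using assms by (auto simp: plane_rotation_def space_PiM PiE_def extensional_def)
qed

lemma distr_plane_rotation:
  assumes p: "p < n" and q: "q < n" and pq: "p \<noteq> q" and cs: "c\<^sup>2 + s\<^sup>2 = 1"
  shows "distr (std_gauss n) (std_gauss n) (plane_rotation p q c s) = std_gauss n"
proof (rule measure_eqI)
  note [measurable] = measurable_plane_rotation[OF p q]
  interpret product_sigma_finite "\<lambda>_ :: nat. std_normal"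
    by unfold_locales (use prob_space_std_normal in \<open>auto simp: prob_space_def finite_measure_def sigma_finite_measure_def\<close>)
  define I where "I = {..<n} - {p, q}"
  have I: "{..<n} = insert p (insert q I)" "finite I" "q \<notin> I" "p \<notin> insert q I"
    using p q pq by (auto simp: I_def)
  \<comment> \<open>integrating over the two coordinates of the plane first\<close>
  have split: "integral\<^sup>N (std_gauss n) F =
      (\<integral>\<^sup>+ x. \<integral>\<^sup>+ b. \<integral>\<^sup>+ a. F (x(q := b, p := a)) \<partial>std_normal \<partial>std_normal \<partial>PiM I (\<lambda>_. std_normal))"
    if F: "F \<in> borel_measurable (std_gauss n)" for F
  proof -
    have F': "F \<in> borel_measurable (PiM (insert p (insert q I)) (\<lambda>_. std_normal))"
      using F by (simp add: std_gauss_def I(1)[symmetric])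
    have "integral\<^sup>N (std_gauss n) F =
      (\<integral>\<^sup>+ x. \<integral>\<^sup>+ a. F (x(p := a)) \<partial>std_normal \<partial>PiM (insert q I) (\<lambda>_. std_normal))"
      unfolding std_gauss_def I(1) using I F' by (intro product_nn_integral_insert) auto
    also have "\<dots> = (\<integral>\<^sup>+ x. \<integral>\<^sup>+ b. \<integral>\<^sup>+ a. F (x(q := b, p := a)) \<partial>std_normal \<partial>std_normal \<partial>PiM I (\<lambda>_. std_normal))"
    proof (rule product_nn_integral_insert[OF I(2,3)])
      note F'[measurable]
      show "(\<lambda>x. \<integral>\<^sup>+ a. F (x(p := a)) \<partial>std_normal) \<in> borel_measurable (PiM (insert q I) (\<lambda>_. std_normal))"
        by measurable
    qed
    finally show ?thesis .
  qed
  fix A assume A: "A \<in> sets (distr (std_gauss n) (std_gauss n) (plane_rotation p q c s))"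
  then have A' [measurable]: "A \<in> sets (PiM {..<n} (\<lambda>_. borel))"
    by (simp add: sets_std_gauss)
  have "emeasure (distr (std_gauss n) (std_gauss n) (plane_rotation p q c s)) A
      = (\<integral>\<^sup>+ x. indicator A x \<partial>distr (std_gauss n) (std_gauss n) (plane_rotation p q c s))"
    using A by simp
  also have "\<dots> = (\<integral>\<^sup>+ x. indicator A (plane_rotation p q c s x) \<partial>std_gauss n)"
    by (rule nn_integral_distr) measurable
  also have "\<dots> = (\<integral>\<^sup>+ x. \<integral>\<^sup>+ b. \<integral>\<^sup>+ a. indicator A (plane_rotation p q c s (x(q := b, p := a)))
      \<partial>std_normal \<partial>std_normal \<partial>PiM I (\<lambda>_. std_normal))"
    by (rule split) measurable
  also have "\<dots> = (\<integral>\<^sup>+ x. \<integral>\<^sup>+ b. \<integral>\<^sup>+ a. indicator A (x(q := b, p := a))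
      \<partial>std_normal \<partial>std_normal \<partial>PiM I (\<lambda>_. std_normal))"
  proof (rule nn_integral_cong)
    fix x assume x: "x \<in> space (PiM I (\<lambda>_. std_normal))"
    then have xI: "x i = undefined" if "i \<notin> I" for i
      using that by (auto simp: space_PiM PiE_def extensional_def)
    have upd: "(\<lambda>y. x(q := snd y, p := fst y)) \<in> borel \<Otimes>\<^sub>M borel \<rightarrow>\<^sub>M PiM {..<n} (\<lambda>_. borel)"
    proof (rule measurable_PiM_single')
      show "(\<lambda>y. (x(q := snd y, p := fst y)) i) \<in> borel_measurable (borel \<Otimes>\<^sub>M borel)" for i
        by (cases "i = q"; cases "i = p") simp_all
      show "(\<lambda>y. x(q := snd y, p := fst y)) \<in> space (borel \<Otimes>\<^sub>M borel) \<rightarrow> {..<n} \<rightarrow>\<^sub>E space borel"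
        using p q xI by (auto simp: space_PiM PiE_def extensional_def I_def)
    qed
    have [measurable]: "(\<lambda>y. indicator A (x(q := snd y, p := fst y)) :: ennreal) \<in> borel_measurable (borel \<Otimes>\<^sub>M borel)"
      by (rule measurable_compose[OF upd borel_measurable_indicator[OF A']])
    have "plane_rotation p q c s (x(q := b, p := a)) = x(q := c * b - s * a, p := c * a + s * b)" for a b
      using pq by (auto simp: plane_rotation_def)
    then show "(\<integral>\<^sup>+ b. \<integral>\<^sup>+ a. indicator A (plane_rotation p q c s (x(q := b, p := a))) \<partial>std_normal \<partial>std_normal)
        = (\<integral>\<^sup>+ b. \<integral>\<^sup>+ a. indicator A (x(q := b, p := a)) \<partial>std_normal \<partial>std_normal)"
      using nn_integral_std_normal_rotate[of "\<lambda>y. indicator A (x(q := snd y, p := fst y))", OF _ cs] by simp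
  qed
  also have "\<dots> = (\<integral>\<^sup>+ x. indicator A x \<partial>std_gauss n)"
    by (rule split[symmetric]) measurable
  also have "\<dots> = emeasure (std_gauss n) A"
    by simp
  finally show "emeasure (distr (std_gauss n) (std_gauss n) (plane_rotation p q c s)) A = emeasure (std_gauss n) A" .
qed simp

section \<open>Triangularization by measure-preserving isometries\<close>

definition coord_map :: "nat \<Rightarrow> real mat \<Rightarrow> (nat \<Rightarrow> real) \<Rightarrow> nat \<Rightarrow> real"
  where "coord_map n Q x = (\<lambda>r\<in>{..<n}. \<Sum>c<n. Q $$ (r, c) * x c)"

lemma measurable_coord_map [measurable]:
  "coord_map n Q \<in> PiM {..<n} (\<lambda>_. borel) \<rightarrow>\<^sub>M PiM {..<n} (\<lambda>_. borel)"
  unfolding coord_map_def by measurable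

text \<open>
  Orthogonal matrices together with the invariance of the Gaussian measure. Every orthogonal matrix
  has this invariance, but it is carried along as part of the notion so that it only has to be proved
  for plane rotations and is inherited by their products.
\<close>

definition gaussian_isometry :: "nat \<Rightarrow> real mat \<Rightarrow> bool"
  where "gaussian_isometry n Q \<longleftrightarrow> Q \<in> carrier_mat n n \<and> Q\<^sup>T * Q = 1\<^sub>m n \<and>
    distr (std_gauss n) (std_gauss n) (coord_map n Q) = std_gauss n"

lemma gaussian_isometry_one: "gaussian_isometry n (1\<^sub>m n)"
proof -
  have "coord_map n (1\<^sub>m n) x = x" if "x \<in> space (std_gauss n)" for x
    using that by (auto simp: coord_map_def space_std_gauss extensional_def sum.delta' if_distrib[of "\<lambda>z. z * _"] cong: if_cong)
  then have "distr (std_gauss n) (std_gauss n) (coord_map n (1\<^sub>m n)) = distr (std_gauss n) (std_gauss n) (\<lambda>x. x)"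
    by (intro distr_cong) auto
  then show ?thesis by (simp add: gaussian_isometry_def)
qed

lemma gaussian_isometry_mult:
  assumes P: "gaussian_isometry n P" and Q: "gaussian_isometry n Q"
  shows "gaussian_isometry n (P * Q)"
proof -
  have c: "P \<in> carrier_mat n n" "Q \<in> carrier_mat n n" and t: "P\<^sup>T * P = 1\<^sub>m n" "Q\<^sup>T * Q = 1\<^sub>m n"
    and d: "distr (std_gauss n) (std_gauss n) (coord_map n P) = std_gauss n"
      "distr (std_gauss n) (std_gauss n) (coord_map n Q) = std_gauss n"
    using P Q by (auto simp: gaussian_isometry_def)
  have "(P * Q)\<^sup>T * (P * Q) = (Q\<^sup>T * P\<^sup>T) * (P * Q)"
    using c by (simp add: transpose_mult)
  also have "\<dots> = Q\<^sup>T * ((P\<^sup>T * P) * Q)"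
    using c by (simp add: assoc_mult_mat[of _ n n _ n _ n])
  finally have 1: "(P * Q)\<^sup>T * (P * Q) = 1\<^sub>m n" using c t by simp
  have comp: "coord_map n (P * Q) = coord_map n P \<circ> coord_map n Q"
  proof
    fix x
    have "(\<Sum>c<n. (P * Q) $$ (r, c) * x c) = (\<Sum>j<n. P $$ (r, j) * (\<Sum>c<n. Q $$ (j, c) * x c))" if "r < n" for r
    proof -
      have "(\<Sum>c<n. (P * Q) $$ (r, c) * x c) = (\<Sum>c<n. \<Sum>j<n. P $$ (r, j) * Q $$ (j, c) * x c)"
        using c that by (intro sum.cong) (auto simp: scalar_prod_def atLeast0LessThan sum_distrib_right)
      also have "\<dots> = (\<Sum>j<n. \<Sum>c<n. P $$ (r, j) * Q $$ (j, c) * x c)"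
        by (rule sum.swap)
      finally show ?thesis by (simp add: sum_distrib_left mult.assoc)
    qed
    then show "coord_map n (P * Q) x = (coord_map n P \<circ> coord_map n Q) x"
      by (auto simp: coord_map_def)
  qed
  have "distr (std_gauss n) (std_gauss n) (coord_map n (P * Q))
      = distr (distr (std_gauss n) (std_gauss n) (coord_map n Q)) (std_gauss n) (coord_map n P)"
    unfolding comp by (rule distr_distr[symmetric]) measurable
  then show ?thesis using c 1 d by (simp add: gaussian_isometry_def)
qed

text \<open>
  The matrix of \<open>plane_rotation p q a b\<close>.
\<close>

definition givens :: "nat \<Rightarrow> nat \<Rightarrow> nat \<Rightarrow> real \<Rightarrow> real \<Rightarrow> real mat"
  where "givens n p q a b = mat n n (\<lambda>(i, j).
    if i = p then (if j = p then a else if j = q then b else 0)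
    else if i = q then (if j = p then - b else if j = q then a else 0)
    else if i = j then 1 else 0)"

lemma givens_carrier [simp]: "givens n p q a b \<in> carrier_mat n n"
  by (simp add: givens_def)

lemma givens_row_sum:
  assumes "p < n" "q < n" "p \<noteq> q" "i < n"
  shows "(\<Sum>j<n. givens n p q a b $$ (i, j) * v j) = plane_rotation p q a b v i"
proof -
  have two: "(\<Sum>j<n. (if j = p then s else if j = q then t else 0) * v j) = s * v p + t * v q" for s t
  proof -
    have "(\<Sum>j<n. (if j = p then s else if j = q then t else 0) * v j)
      = (\<Sum>j<n. (if j = p then s * v j else 0) + (if j = q then t * v j else 0))"
      using assms by (intro sum.cong) auto
    then show ?thesis using assms by (simp add: sum.distrib)
  qed
  have one: "(\<Sum>j<n. (if i = j then 1 else 0) * v j) = v i"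
    using assms by (simp add: if_distrib[of "\<lambda>z. z * _"] cong: if_cong)
  have "(\<Sum>j<n. givens n p q a b $$ (i, j) * v j) = (\<Sum>j<n. (if i = p then (if j = p then a else if j = q then b else 0)
    else if i = q then (if j = p then - b else if j = q then a else 0)
    else if i = j then 1 else 0) * v j)"
    using assms by (intro sum.cong) (auto simp: givens_def)
  then show ?thesis
    using assms two[of a b] two[of "- b" a] one
    by (cases "i = p"; cases "i = q") (auto simp: plane_rotation_def)
qed

lemma givens_mult_index:
  assumes "p < n" "q < n" "p \<noteq> q" "i < n" "c < k" "T \<in> carrier_mat n k"
  shows "(givens n p q a b * T) $$ (i, c) = plane_rotation p q a b (\<lambda>j. T $$ (j, c)) i"
proof -
  have "(givens n p q a b * T) $$ (i, c) = (\<Sum>j<n. givens n p q a b $$ (i, j) * T $$ (j, c))"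
    using assms givens_carrier[of n p q a b]
    by (auto simp: scalar_prod_def atLeast0LessThan simp del: givens_carrier intro!: sum.cong)
  then show ?thesis using givens_row_sum[OF assms(1-4)] by simp
qed

lemma gaussian_isometry_givens:
  assumes pq: "p < n" "q < n" "p \<noteq> q" and ab: "a\<^sup>2 + b\<^sup>2 = 1"
  shows "gaussian_isometry n (givens n p q a b)"
proof -
  have tr: "(givens n p q a b)\<^sup>T = givens n p q a (- b)"
    using pq by (intro eq_matI) (auto simp: givens_def)
  have ab': "a * a + b * b = 1" using ab by (simp add: power2_eq_square)
  have "(givens n p q a b)\<^sup>T * givens n p q a b = 1\<^sub>m n"
    unfolding tr
  proof (rule eq_matI)
    fix i j assume ij: "i < dim_row (1\<^sub>m n)" "j < dim_col (1\<^sub>m n)"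
    then have "(givens n p q a (- b) * givens n p q a b) $$ (i, j)
        = plane_rotation p q a (- b) (\<lambda>l. givens n p q a b $$ (l, j)) i"
      using pq by (intro givens_mult_index) auto
    then show "(givens n p q a (- b) * givens n p q a b) $$ (i, j) = 1\<^sub>m n $$ (i, j)"
      using ij pq ab' by (auto simp: plane_rotation_def givens_def mult.commute add.commute)
  qed (simp_all add: givens_def)
  moreover have "coord_map n (givens n p q a b) x = plane_rotation p q a b x" if "x \<in> space (std_gauss n)" for x
    using that pq by (auto simp: coord_map_def givens_row_sum space_std_gauss extensional_def plane_rotation_def)
  then have "distr (std_gauss n) (std_gauss n) (coord_map n (givens n p q a b))
      = distr (std_gauss n) (std_gauss n) (plane_rotation p q a b)"
    by (intro distr_cong) auto
  ultimately show ?thesis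
    using distr_plane_rotation[OF pq ab] by (simp add: gaussian_isometry_def)
qed

lemma rotation_annihilates:
  obtains a b :: real where "a\<^sup>2 + b\<^sup>2 = 1" "a * v - b * u = 0"
proof (cases "u = 0 \<and> v = 0")
  case True
  then show thesis using that[of 1 0] by simp
next
  case False
  define r where "r = sqrt (u\<^sup>2 + v\<^sup>2)"
  have r: "r \<noteq> 0" "r\<^sup>2 = u\<^sup>2 + v\<^sup>2" using False by (auto simp: r_def sum_power2_eq_zero_iff)
  have "(u / r)\<^sup>2 + (v / r)\<^sup>2 = (u\<^sup>2 + v\<^sup>2) / r\<^sup>2"
    by (simp add: power_divide add_divide_distrib)
  also have "\<dots> = 1" unfolding r(2)[symmetric] using r(1) by simp
  finally have "(u / r)\<^sup>2 + (v / r)\<^sup>2 = 1" .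
  then show thesis using that[of "u / r" "v / r"] by (simp add: mult.commute)
qed

text \<open>
  One column of the triangularization: rotating in the plane of the coordinates \<open>c\<close> and \<open>d\<close> removes the entry
  \<open>(d, c)\<close>. Columns to the left of \<open>c\<close> keep their zeros, because in them both rows
  involved vanish.
\<close>

lemma qr_column:
  assumes T: "T \<in> carrier_mat n k" and c: "c < k"
    and tri: "\<And>c' r. \<lbrakk>c' < c; c' < r; r < n\<rbrakk> \<Longrightarrow> T $$ (r, c') = 0"
  shows "d \<le> n \<Longrightarrow> \<exists>G. gaussian_isometry n G \<and>
    (\<forall>c' r. c' < c \<and> c' < r \<and> r < n \<longrightarrow> (G * T) $$ (r, c') = 0) \<and>
    (\<forall>r<d. c < r \<longrightarrow> (G * T) $$ (r, c) = 0)"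
proof (induction d)
  case 0
  show ?case using gaussian_isometry_one[of n] T tri by (intro exI[of _ "1\<^sub>m n"]) auto
next
  case (Suc d)
  then obtain G where G: "gaussian_isometry n G"
      and G1: "\<And>c' r. \<lbrakk>c' < c; c' < r; r < n\<rbrakk> \<Longrightarrow> (G * T) $$ (r, c') = 0"
      and G2: "\<And>r. \<lbrakk>r < d; c < r\<rbrakk> \<Longrightarrow> (G * T) $$ (r, c) = 0"
    by auto
  show ?case
  proof (cases "c < d")
    case False
    then show ?thesis using G G1 by (intro exI[of _ G]) auto
  next
    case True
    have Gc: "G \<in> carrier_mat n n" using G by (simp add: gaussian_isometry_def)
    then have GT: "G * T \<in> carrier_mat n k" using T by simp
    obtain a b where ab: "a\<^sup>2 + b\<^sup>2 = 1" "a * (G * T) $$ (d, c) - b * (G * T) $$ (c, c) = 0"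
      using rotation_annihilates by blast
    let ?R = "givens n c d a b"
    have cd: "c < n" "d < n" "c \<noteq> d" using True Suc.prems by auto
    have idx: "(?R * G * T) $$ (r, j) = plane_rotation c d a b (\<lambda>l. (G * T) $$ (l, j)) r"
      if "r < n" "j < k" for r j
      using givens_mult_index[OF cd that GT] assoc_mult_mat[OF givens_carrier Gc T] by simp
    have "gaussian_isometry n (?R * G)"
      using gaussian_isometry_mult[OF gaussian_isometry_givens[OF cd ab(1)] G] .
    moreover have "(?R * G * T) $$ (r, c') = 0" if "c' < c" "c' < r" "r < n" for c' r
      using that c True Suc.prems G1 by (simp add: idx plane_rotation_def)
    moreover have "(?R * G * T) $$ (r, c) = 0" if "r < Suc d" "c < r" for r
      using that c Suc.prems G2 ab by (auto simp: idx plane_rotation_def less_Suc_eq)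
    ultimately show ?thesis by blast
  qed
qed

lemma qr_gaussian_isometry:
  assumes X: "X \<in> carrier_mat n k"
  obtains Q where "gaussian_isometry n Q"
    and "\<And>c r. \<lbrakk>c < k; c < r; r < n\<rbrakk> \<Longrightarrow> (Q * X) $$ (r, c) = 0"
proof -
  have "\<exists>Q. gaussian_isometry n Q \<and> (\<forall>c' r. c' < c \<and> c' < r \<and> r < n \<longrightarrow> (Q * X) $$ (r, c') = 0)" if "c \<le> k" for c
    using that
  proof (induction c)
    case 0
    show ?case using gaussian_isometry_one by auto
  next
    case (Suc c)
    then obtain Q where Q: "gaussian_isometry n Q"
      and Q0: "\<And>c' r. \<lbrakk>c' < c; c' < r; r < n\<rbrakk> \<Longrightarrow> (Q * X) $$ (r, c') = 0" by auto
    have Qc: "Q \<in> carrier_mat n n" using Q by (simp add: gaussian_isometry_def)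
    have QX: "Q * X \<in> carrier_mat n k" using Qc X by simp
    obtain G where G: "gaussian_isometry n G"
      and G1: "\<And>c' r. \<lbrakk>c' < c; c' < r; r < n\<rbrakk> \<Longrightarrow> (G * (Q * X)) $$ (r, c') = 0"
      and G2: "\<And>r. \<lbrakk>r < n; c < r\<rbrakk> \<Longrightarrow> (G * (Q * X)) $$ (r, c) = 0"
      using qr_column[OF QX _ Q0, of c n] Suc.prems by auto
    have Gc: "G \<in> carrier_mat n n" using G by (simp add: gaussian_isometry_def)
    have "G * (Q * X) = G * Q * X" using assoc_mult_mat[OF Gc Qc X] by simp
    then show ?case
      using G1 G2 gaussian_isometry_mult[OF G Q]
      by (intro exI[of _ "G * Q"]) (auto simp: less_Suc_eq)
  qed
  from this[OF order.refl] that show thesis by blast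
qed

section \<open>Least squares residuals\<close>

lemma scalar_prod_self_eq_0:
  fixes v :: "real vec"
  assumes "v \<in> carrier_vec n" "v \<bullet> v = 0"
  shows "v = 0\<^sub>v n"
  using assms by (intro eq_vecI) (auto simp: scalar_prod_def sum_nonneg_eq_0_iff)

text \<open>
  The rank is the dimension of the span of the set of columns, so repeated columns have to
  be excluded before the kernel can be expressed by linear independence of that set.
\<close>

lemma full_column_rank_injective:
  fixes X :: "real mat"
  assumes X: "X \<in> carrier_mat n k" and r: "vec_space.rank n X = k"
    and v: "v \<in> carrier_vec k" "X *\<^sub>v v = 0\<^sub>v n"
  shows "v = 0\<^sub>v k"
proof -
  interpret vec_space "TYPE(real)" n .
  have "distinct (cols X)"
  proof (rule ccontr)
    assume nd: "\<not> distinct (cols X)"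
    obtain S where S: "maximal S (\<lambda>T. T \<subseteq> set (cols X) \<and> lin_indpt T)"
      using maximal_exists[of "(\<lambda>T. T \<subseteq> set (cols X) \<and> lin_indpt T)" "card (set (cols X))" "{}"]
      by (meson List.finite_set card_mono empty_iff empty_subsetI finite_lin_indpt2 rev_finite_subset)
    then have "card S \<le> card (set (cols X))" by (simp add: card_mono maximal_def)
    also have "\<dots> < k"
      using nd X card_length[of "cols X"] card_distinct[of "cols X"] by (auto simp: nat_less_le)
    finally show False using rank_card_indpt[OF X S] r by simp
  qed
  then show ?thesis
    using full_rank_lin_indpt[OF X r] lin_depI[OF X v(1) _ v(2)] by blast
qed

lemma matinv_inverse:
  assumes A: "A \<in> carrier_mat n n" and d: "det A \<noteq> 0"
  shows "matinv A \<in> carrier_mat n n" "A * matinv A = 1\<^sub>m n" "matinv A * A = 1\<^sub>m n"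
proof -
  have "A \<in> Units (ring_mat TYPE(real) n ())" by (rule det_non_zero_imp_unit[OF A d])
  then obtain B where B: "mat_inverse A = Some B"
    using mat_inverse(1)[OF A, of "()"] by (cases "mat_inverse A") auto
  then show "matinv A \<in> carrier_mat n n" "A * matinv A = 1\<^sub>m n" "matinv A * A = 1\<^sub>m n"
    using mat_inverse(2)[OF A B] by (auto simp: matinv_def)
qed

locale full_rank_design =
  fixes X :: "real mat" and n k :: nat
  assumes X: "X \<in> carrier_mat n k" and rank: "vec_space.rank n X = k" and k: "k < n"
begin

text \<open>
  The matrix of the least squares estimator as a linear function of the observations.
\<close>

definition W :: "real mat" where "W = matinv (X\<^sup>T * X) * X\<^sup>T"

lemma gram_carrier: "X\<^sup>T * X \<in> carrier_mat k k"
  using X by simp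

lemma det_gram: "det (X\<^sup>T * X) \<noteq> 0"
proof
  assume "det (X\<^sup>T * X) = 0"
  then obtain v where v: "v \<in> carrier_vec k" "v \<noteq> 0\<^sub>v k" "(X\<^sup>T * X) *\<^sub>v v = 0\<^sub>v k"
    using det_0_iff_vec_prod_zero[OF gram_carrier] by auto
  have "(X *\<^sub>v v) \<bullet> (X *\<^sub>v v) = (X\<^sup>T *\<^sub>v (X *\<^sub>v v)) \<bullet> v"
    using X v by (intro transpose_vec_mult_scalar[symmetric]) auto
  also have "X\<^sup>T *\<^sub>v (X *\<^sub>v v) = 0\<^sub>v k"
    using X v by (simp add: assoc_mult_mat_vec[of _ k n _ k])
  finally have "(X *\<^sub>v v) \<bullet> (X *\<^sub>v v) = 0" using v by simp
  then have "X *\<^sub>v v = 0\<^sub>v n"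
    using X v by (intro scalar_prod_self_eq_0) auto
  then show False using full_column_rank_injective[OF X rank v(1)] v(2) by simp
qed

lemmas gram_inverse = matinv_inverse[OF gram_carrier det_gram]

lemma W_carrier: "W \<in> carrier_mat k n"
  unfolding W_def using X gram_inverse(1) by simp

lemma W_X: "W * X = 1\<^sub>m k"
  unfolding W_def using X gram_inverse by (simp add: assoc_mult_mat[of _ k k _ n _ k])

lemma theta_LS_eq:
  assumes "\<theta> \<in> carrier_vec k" "u \<in> carrier_vec n"
  shows "theta_LS X (X *\<^sub>v \<theta> + u) = \<theta> + W *\<^sub>v u"
proof -
  have "theta_LS X (X *\<^sub>v \<theta> + u) = W *\<^sub>v (X *\<^sub>v \<theta>) + W *\<^sub>v u"
    unfolding theta_LS_def W_def[symmetric]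
    using assms X W_carrier by (intro mult_add_distrib_mat_vec) auto
  also have "W *\<^sub>v (X *\<^sub>v \<theta>) = (W * X) *\<^sub>v \<theta>"
    using assms X W_carrier by (intro assoc_mult_mat_vec[symmetric]) auto
  finally show ?thesis using assms by (simp add: W_X)
qed

lemma residual_eq:
  assumes "\<theta> \<in> carrier_vec k" "u \<in> carrier_vec n"
  shows "X *\<^sub>v \<theta> + u - X *\<^sub>v theta_LS X (X *\<^sub>v \<theta> + u) = u - X *\<^sub>v (W *\<^sub>v u)"
proof -
  have Wu: "W *\<^sub>v u \<in> carrier_vec k" using W_carrier assms by simp
  show ?thesis
    unfolding theta_LS_eq[OF assms] mult_add_distrib_mat_vec[OF X assms(1) Wu]
    using X W_carrier assms by (intro eq_vecI) auto
qed

text \<open>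
  This is the diagonal of \<open>W W\<^sup>T = (X\<^sup>T X)\<^sup>-\<^sup>1\<close>: up to the factor \<open>\<sigma>\<^sup>2\<close>, the variance of the
  least squares estimator.
\<close>

lemma W_row_norm:
  assumes i: "i < k"
  shows "(\<Sum>j<n. (W $$ (i, j))\<^sup>2) = matinv (X\<^sup>T * X) $$ (i, i)"
proof -
  let ?A = "matinv (X\<^sup>T * X)"
  have A: "?A \<in> carrier_mat k k" by (rule gram_inverse(1))
  have Wt: "W\<^sup>T = X * ?A\<^sup>T" unfolding W_def using X A by (simp add: transpose_mult[of _ k k _ n])
  have "W * W\<^sup>T = (W * X) * ?A\<^sup>T"
    unfolding Wt using X A W_carrier by (intro assoc_mult_mat[symmetric]) auto
  also have "\<dots> = ?A\<^sup>T" using A by (simp add: W_X)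
  finally have "(W * W\<^sup>T) $$ (i, i) = ?A $$ (i, i)" using A i by simp
  moreover have "(W * W\<^sup>T) $$ (i, i) = (\<Sum>j<n. (W $$ (i, j))\<^sup>2)"
    using W_carrier i by (auto simp: scalar_prod_def power2_eq_square atLeast0LessThan intro!: sum.cong)
  ultimately show ?thesis by simp
qed

lemma W_row_nonzero:
  assumes i: "i < k"
  shows "0 < (\<Sum>j<n. (W $$ (i, j))\<^sup>2)"
proof (rule ccontr)
  assume "\<not> 0 < (\<Sum>j<n. (W $$ (i, j))\<^sup>2)"
  moreover have "0 \<le> (\<Sum>j<n. (W $$ (i, j))\<^sup>2)" by (intro sum_nonneg) auto
  ultimately have "(\<Sum>j<n. (W $$ (i, j))\<^sup>2) = 0" by linarith
  then have z: "W $$ (i, j) = 0" if "j < n" for j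
    using that by (simp add: sum_nonneg_eq_0_iff)
  have "(W * X) $$ (i, i) = (\<Sum>j<n. W $$ (i, j) * X $$ (j, i))"
    using X W_carrier i by (auto simp: scalar_prod_def atLeast0LessThan intro!: sum.cong)
  also have "\<dots> = 0" using z by simp
  finally show False using i by (simp add: W_X)
qed

lemma xi_square:
  assumes i: "i < k"
  shows "(xi X i)\<^sup>2 = n * (\<Sum>j<n. (W $$ (i, j))\<^sup>2)" "0 < xi X i"
proof -
  let ?A = "matinv (X\<^sup>T * X)"
  have n: "0 < n" using k by simp
  note [simp] = gram_inverse gram_carrier
  have cancel: "real n \<cdot>\<^sub>m ((1 / real n) \<cdot>\<^sub>m 1\<^sub>m k) = 1\<^sub>m k" "(1 / real n) \<cdot>\<^sub>m (real n \<cdot>\<^sub>m 1\<^sub>m k) = 1\<^sub>m k"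
    using n by (auto intro!: eq_matI)
  have "matinv ((1 / real n) \<cdot>\<^sub>m (X\<^sup>T * X)) = real n \<cdot>\<^sub>m ?A"
  proof (rule matinv_unique[of _ k])
    show "(1 / real n) \<cdot>\<^sub>m (X\<^sup>T * X) * (real n \<cdot>\<^sub>m ?A) = 1\<^sub>m k"
      using n by (simp add: mult_smult_distrib[of _ k k _ k] mult_smult_assoc_mat[of _ k k _ k] cancel)
    show "real n \<cdot>\<^sub>m ?A * ((1 / real n) \<cdot>\<^sub>m (X\<^sup>T * X)) = 1\<^sub>m k"
      using n by (simp add: mult_smult_distrib[of _ k k _ k] mult_smult_assoc_mat[of _ k k _ k] cancel)
  qed auto
  then have "xi X i = sqrt (n * ?A $$ (i, i))"
    using X i carrier_matD[OF gram_inverse(1)] by (simp add: xi_def)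
  then have "xi X i = sqrt (n * (\<Sum>j<n. (W $$ (i, j))\<^sup>2))"
    by (simp add: W_row_norm[OF i])
  then show "(xi X i)\<^sup>2 = n * (\<Sum>j<n. (W $$ (i, j))\<^sup>2)" "0 < xi X i"
    using W_row_nonzero[OF i] n by simp_all
qed

text \<open>
  Let \<open>Q X = T\<close> be upper triangular and let \<open>w = Q e\<close> be the rotated residual vector. The normal equations
  say \<open>T\<^sup>T w = 0\<close>. As the upper \<open>k \<times> k\<close> block of \<open>T\<close> is invertible and the rows below it vanish, the
  first \<open>k\<close> entries of \<open>w\<close> are zero. The other entries of \<open>w\<close> agree with those of \<open>Q u\<close>, because
  \<open>Q X b = T b\<close> vanishes there.
\<close>

lemma residual_rotated:
  obtains Q where "gaussian_isometry n Q"
    and "\<And>u. u \<in> carrier_vec n \<Longrightarrow>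
      (u - X *\<^sub>v (W *\<^sub>v u)) \<bullet> (u - X *\<^sub>v (W *\<^sub>v u)) = (\<Sum>r\<in>{k..<n}. ((Q *\<^sub>v u) $ r)\<^sup>2)"
proof -
  obtain Q where Q: "gaussian_isometry n Q"
    and Q0: "\<And>c r. \<lbrakk>c < k; c < r; r < n\<rbrakk> \<Longrightarrow> (Q * X) $$ (r, c) = 0"
    using qr_gaussian_isometry[OF X] by blast
  have Qc: "Q \<in> carrier_mat n n" and QQ: "Q\<^sup>T * Q = 1\<^sub>m n" using Q by (auto simp: gaussian_isometry_def)
  define T where "T = Q * X"
  have T: "T \<in> carrier_mat n k" using Qc X by (simp add: T_def)
  have T0: "T $$ (r, c) = 0" if "c < k" "k \<le> r" "r < n" for r c
    using Q0[of c r] that by (simp add: T_def)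
  define R where "R = mat k k (\<lambda>(i, j). T $$ (i, j))"
  have R: "R \<in> carrier_mat k k" by (simp add: R_def)
  have T_inj: "v = 0\<^sub>v k" if v: "v \<in> carrier_vec k" and "T *\<^sub>v v = 0\<^sub>v n" for v
  proof -
    have "X *\<^sub>v v = (Q\<^sup>T * Q) *\<^sub>v (X *\<^sub>v v)" using QQ X v by simp
    also have "\<dots> = Q\<^sup>T *\<^sub>v (Q *\<^sub>v (X *\<^sub>v v))" using Qc X v by (intro assoc_mult_mat_vec) auto
    also have "Q *\<^sub>v (X *\<^sub>v v) = T *\<^sub>v v" unfolding T_def using Qc X v by (intro assoc_mult_mat_vec[symmetric]) auto
    finally have "X *\<^sub>v v = 0\<^sub>v n" using that Qc by auto
    then show ?thesis using full_column_rank_injective[OF X rank v] by simp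
  qed
  have "det R \<noteq> 0"
  proof
    assume "det R = 0"
    then obtain v where v: "v \<in> carrier_vec k" "v \<noteq> 0\<^sub>v k" "R *\<^sub>v v = 0\<^sub>v k"
      using det_0_iff_vec_prod_zero[OF R] by auto
    have "T *\<^sub>v v = 0\<^sub>v n"
    proof (rule eq_vecI)
      fix r assume "r < dim_vec (0\<^sub>v n)"
      then have r: "r < n" by simp
      have "(T *\<^sub>v v) $ r = (\<Sum>c<k. T $$ (r, c) * v $ c)"
        using T v r by (auto simp: scalar_prod_def atLeast0LessThan intro!: sum.cong)
      also have "\<dots> = 0"
      proof (cases "r < k")
        case True
        then have "(R *\<^sub>v v) $ r = (\<Sum>c<k. T $$ (r, c) * v $ c)"
          using v(1) by (auto simp: R_def scalar_prod_def atLeast0LessThan intro!: sum.cong)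
        then show ?thesis unfolding v(3) using True by simp
      next
        case False
        then show ?thesis using T0 r by simp
      qed
      finally show "(T *\<^sub>v v) $ r = 0\<^sub>v n $ r" using r by simp
    qed (use T in auto)
    then show False using T_inj v by blast
  qed
  then have detRt: "det R\<^sup>T \<noteq> 0" using det_transpose[OF R] by simp
  have "(u - X *\<^sub>v (W *\<^sub>v u)) \<bullet> (u - X *\<^sub>v (W *\<^sub>v u)) = (\<Sum>r\<in>{k..<n}. ((Q *\<^sub>v u) $ r)\<^sup>2)"
    if u: "u \<in> carrier_vec n" for u
  proof -
    define b where "b = W *\<^sub>v u"
    have b: "b \<in> carrier_vec k" using W_carrier u by (simp add: b_def)
    define e where "e = u - X *\<^sub>v b"
    have e: "e \<in> carrier_vec n" using X b u by (simp add: e_def)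
    define w where "w = Q *\<^sub>v e"
    have w: "w \<in> carrier_vec n" using Qc e by (simp add: w_def)
    have Xe: "X\<^sup>T *\<^sub>v e = 0\<^sub>v k"
    proof -
      have b': "b = matinv (X\<^sup>T * X) *\<^sub>v (X\<^sup>T *\<^sub>v u)"
        unfolding b_def W_def using X u gram_inverse(1) by (intro assoc_mult_mat_vec) auto
      have "X\<^sup>T *\<^sub>v (X *\<^sub>v b) = (X\<^sup>T * X) *\<^sub>v (matinv (X\<^sup>T * X) *\<^sub>v (X\<^sup>T *\<^sub>v u))"
        unfolding b'[symmetric] using X b by (intro assoc_mult_mat_vec[symmetric]) auto
      also have "(X\<^sup>T * X) *\<^sub>v (matinv (X\<^sup>T * X) *\<^sub>v (X\<^sup>T *\<^sub>v u)) = (X\<^sup>T * X * matinv (X\<^sup>T * X)) *\<^sub>v (X\<^sup>T *\<^sub>v u)"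
        using X u gram_inverse(1) by (intro assoc_mult_mat_vec[symmetric]) auto
      also have "\<dots> = X\<^sup>T *\<^sub>v u" using X u by (simp add: gram_inverse)
      finally have "X\<^sup>T *\<^sub>v (X *\<^sub>v b) = X\<^sup>T *\<^sub>v u" .
      moreover have "X\<^sup>T *\<^sub>v e = X\<^sup>T *\<^sub>v u - X\<^sup>T *\<^sub>v (X *\<^sub>v b)"
        unfolding e_def using X u b by (intro mult_minus_distrib_mat_vec) auto
      ultimately show ?thesis using X u by simp
    qed
    have norm: "w \<bullet> w = e \<bullet> e"
    proof -
      have "w \<bullet> w = (Q\<^sup>T *\<^sub>v w) \<bullet> e"
        unfolding w_def using Qc e by (intro transpose_vec_mult_scalar[symmetric]) auto
      also have "Q\<^sup>T *\<^sub>v w = (Q\<^sup>T * Q) *\<^sub>v e"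
        unfolding w_def using Qc e by (intro assoc_mult_mat_vec[symmetric]) auto
      finally show ?thesis using e by (simp add: QQ)
    qed
    have Tw: "T\<^sup>T *\<^sub>v w = 0\<^sub>v k"
    proof -
      have "T\<^sup>T *\<^sub>v w = X\<^sup>T *\<^sub>v (Q\<^sup>T *\<^sub>v w)"
        unfolding T_def using Qc X w by (simp add: transpose_mult[of _ n n _ k] assoc_mult_mat_vec[of _ k n _ n])
      also have "Q\<^sup>T *\<^sub>v w = (Q\<^sup>T * Q) *\<^sub>v e"
        unfolding w_def using Qc e by (intro assoc_mult_mat_vec[symmetric]) auto
      finally show ?thesis using e by (simp add: QQ Xe)
    qed
    have low: "w $ r = 0" if "r < k" for r
    proof -
      define w' where "w' = vec k (\<lambda>r. w $ r)"
      have "R\<^sup>T *\<^sub>v w' = 0\<^sub>v k"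
      proof (rule eq_vecI)
        fix c assume "c < dim_vec (0\<^sub>v k)"
        then have c: "c < k" by simp
        have "(R\<^sup>T *\<^sub>v w') $ c = (\<Sum>r<k. T $$ (r, c) * w $ r)"
          using c by (auto simp: R_def w'_def scalar_prod_def atLeast0LessThan intro!: sum.cong)
        also have "\<dots> = (\<Sum>r<n. T $$ (r, c) * w $ r)"
          using k c T0 by (intro sum.mono_neutral_left) auto
        also have "\<dots> = (T\<^sup>T *\<^sub>v w) $ c"
          using c T w by (auto simp: scalar_prod_def atLeast0LessThan intro!: sum.cong)
        finally show "(R\<^sup>T *\<^sub>v w') $ c = 0\<^sub>v k $ c" using c by (simp add: Tw)
      qed (simp add: R_def)
      moreover have "w' \<in> carrier_vec k" by (simp add: w'_def)
      ultimately have "w' = 0\<^sub>v k"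
        using det_0_iff_vec_prod_zero[OF transpose_carrier_mat[THEN iffD2, OF R]] detRt by blast
      then have "w' $ r = 0" using that by simp
      then show ?thesis using that by (simp add: w'_def)
    qed
    have high: "w $ r = (Q *\<^sub>v u) $ r" if r: "k \<le> r" "r < n" for r
    proof -
      have "w = Q *\<^sub>v u - Q *\<^sub>v (X *\<^sub>v b)"
        unfolding w_def e_def using Qc X u b by (intro mult_minus_distrib_mat_vec) auto
      also have "Q *\<^sub>v (X *\<^sub>v b) = T *\<^sub>v b"
        unfolding T_def using Qc X b by (intro assoc_mult_mat_vec[symmetric]) auto
      finally have "w = Q *\<^sub>v u - T *\<^sub>v b" .
      moreover have "(T *\<^sub>v b) $ r = 0"
        using T b r T0 by (auto simp: scalar_prod_def intro!: sum.neutral)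
      ultimately show ?thesis using r Qc T by simp
    qed
    have "e \<bullet> e = (\<Sum>r<n. (w $ r)\<^sup>2)"
      unfolding norm[symmetric] using w by (simp add: scalar_prod_def power2_eq_square atLeast0LessThan)
    also have "\<dots> = (\<Sum>r\<in>{k..<n}. (w $ r)\<^sup>2)"
      using low by (intro sum.mono_neutral_right) auto
    also have "\<dots> = (\<Sum>r\<in>{k..<n}. ((Q *\<^sub>v u) $ r)\<^sup>2)"
      using high by (intro sum.cong) auto
    finally show ?thesis by (simp add: e_def b_def)
  qed
  with Q that show thesis by blast
qed

lemma residual_law:
  "distr (std_gauss n) borel
     (\<lambda>x. (vec n x - X *\<^sub>v (W *\<^sub>v vec n x)) \<bullet> (vec n x - X *\<^sub>v (W *\<^sub>v vec n x))) = chi_square (n - k)"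
proof -
  obtain Q where Q: "gaussian_isometry n Q"
    and RSS: "\<And>u. u \<in> carrier_vec n \<Longrightarrow>
      (u - X *\<^sub>v (W *\<^sub>v u)) \<bullet> (u - X *\<^sub>v (W *\<^sub>v u)) = (\<Sum>r\<in>{k..<n}. ((Q *\<^sub>v u) $ r)\<^sup>2)"
    using residual_rotated by blast
  have Qc: "Q \<in> carrier_mat n n" and Qd: "distr (std_gauss n) (std_gauss n) (coord_map n Q) = std_gauss n"
    using Q by (auto simp: gaussian_isometry_def)
  have Qx: "(Q *\<^sub>v vec n x) $ r = coord_map n Q x r" if "r < n" for x r
    using that Qc by (auto simp: coord_map_def scalar_prod_def atLeast0LessThan intro!: sum.cong)
  define tail where "tail x = (\<Sum>r\<in>{k..<n}. (x r)\<^sup>2)" for x :: "nat \<Rightarrow> real"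
  have tail_m [measurable]: "tail \<in> borel_measurable (PiM {..<n} (\<lambda>_. borel))" unfolding tail_def by measurable
  have "distr (std_gauss n) borel
     (\<lambda>x. (vec n x - X *\<^sub>v (W *\<^sub>v vec n x)) \<bullet> (vec n x - X *\<^sub>v (W *\<^sub>v vec n x)))
    = distr (std_gauss n) borel (tail \<circ> coord_map n Q)"
    by (intro distr_cong) (auto simp: RSS Qx tail_def)
  also have "\<dots> = distr (distr (std_gauss n) (std_gauss n) (coord_map n Q)) borel tail"
    by (intro distr_distr[symmetric]) measurable
  also have "\<dots> = distr (std_gauss n) borel tail" by (simp add: Qd)
  also have "\<dots> = distr (std_gauss n) borel ((\<lambda>x. \<Sum>j<n - k. (x j)\<^sup>2) \<circ> (\<lambda>x. \<lambda>j\<in>{..<n - k}. x (j + k)))"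
  proof (intro distr_cong refl)
    fix x :: "nat \<Rightarrow> real"
    have "tail x = (\<Sum>j<n - k. (x (j + k))\<^sup>2)"
      unfolding tail_def using k sum.shift_bounds_nat_ivl[of "\<lambda>r. (x r)\<^sup>2" 0 k "n - k"]
      by (simp add: atLeast0LessThan)
    then show "tail x = ((\<lambda>x. \<Sum>j<n - k. (x j)\<^sup>2) \<circ> (\<lambda>x. \<lambda>j\<in>{..<n - k}. x (j + k))) x"
      by simp
  qed
  also have "\<dots> = distr (distr (std_gauss n) (std_gauss (n - k)) (\<lambda>x. \<lambda>j\<in>{..<n - k}. x (j + k))) borel (\<lambda>x. \<Sum>j<n - k. (x j)\<^sup>2)"
    by (intro distr_distr[symmetric]) measurable
  also have "distr (std_gauss n) (std_gauss (n - k)) (\<lambda>x. \<lambda>j\<in>{..<n - k}. x (j + k)) = std_gauss (n - k)"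
    unfolding std_gauss_def using prob_space_std_normal
    by (intro distr_PiM_reindex[of "{..<n}" "\<lambda>_. std_normal" "\<lambda>j. j + k" "{..<n - k}"]) auto
  finally show ?thesis by (simp add: chi_square_std_gauss)
qed

end

section \<open>The density of the normalized chi distribution\<close>

text \<open>
  The law whose density is \<open>rho m\<close>. It is the law of the ratio of the estimated to the
  true standard deviation with \<open>m\<close> residual degrees of freedom.
\<close>

definition chi_law :: "nat \<Rightarrow> real measure"
  where "chi_law m = distr (chi_square m) borel (\<lambda>x. sqrt x / sqrt (real m))"

lemma prob_space_chi_square: "prob_space (chi_square m)"
  unfolding chi_square_std_gauss
  by (intro prob_space.prob_space_distr[OF prob_space_std_gauss]) measurable

lemma sets_chi_square [measurable_cong]: "sets (chi_square m) = sets borel"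
  by (simp add: chi_square_def)

lemma prob_space_chi_law: "prob_space (chi_law m)"
  unfolding chi_law_def by (intro prob_space.prob_space_distr[OF prob_space_chi_square]) measurable

lemma sets_chi_law [measurable_cong]: "sets (chi_law m) = sets borel"
  by (simp add: chi_law_def)

lemma space_chi_law: "space (chi_law m) = UNIV"
  by (simp add: chi_law_def)

lemma chi_law_std_gauss:
  "chi_law m = distr (std_gauss m) borel (\<lambda>x. sqrt ((\<Sum>j<m. (x j)\<^sup>2) / m))"
  by (simp add: chi_law_def chi_square_std_gauss distr_distr comp_def real_sqrt_divide)

text \<open>
  Apart from \<open>x = 0\<close>, the preimage is covered by the images of a null set under the two branches
  \<open>y \<mapsto> \<plusminus> sqrt (m y\<^sup>2 - d)\<close> of the inverse, which are differentiable where the radicand is positive.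
\<close>

lemma null_sets_preimage_norm:
  assumes A: "A \<in> null_sets lborel" and m: "0 < m" and d: "0 \<le> d"
  shows "{x. sqrt ((x\<^sup>2 + d) / m) \<in> A} \<in> null_sets lborel"
proof -
  have A': "A \<in> sets borel" using A by auto
  define S where "S = {y \<in> A. d < m * y\<^sup>2}"
  define f where "f y = sqrt (m * y\<^sup>2 - d)" for y
  have neg: "negligible S"
    using A by (intro negligible_subset[of A S])
       (auto simp: S_def negligible_iff_null_sets intro: null_sets_completionI)
  have "f differentiable_on S"
    unfolding f_def differentiable_on_def
  proof
    fix y assume "y \<in> S"
    then have "0 < m * y\<^sup>2 - d" by (simp add: S_def)
    then have "((\<lambda>y. sqrt (m * y\<^sup>2 - d)) has_real_derivative
        (2 * m * y) * (inverse (sqrt (m * y\<^sup>2 - d)) / 2)) (at y within S)"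
      by (auto intro!: derivative_eq_intros)
    then show "(\<lambda>y. sqrt (m * y\<^sup>2 - d)) differentiable at y within S"
      using real_differentiable_def by blast
  qed
  then have nf: "negligible (f ` S)"
    by (intro negligible_differentiable_image_negligible neg) auto
  have "negligible ((\<lambda>x. - x) ` f ` S)"
    by (intro negligible_differentiable_image_negligible nf) (auto intro!: derivative_intros)
  then have "negligible (f ` S \<union> (\<lambda>x. - x) ` f ` S \<union> {0})"
    using nf by auto
  moreover have "{x. sqrt ((x\<^sup>2 + d) / m) \<in> A} \<subseteq> f ` S \<union> (\<lambda>x. - x) ` f ` S \<union> {0}"
  proof
    fix x assume x: "x \<in> {x. sqrt ((x\<^sup>2 + d) / m) \<in> A}"
    let ?y = "sqrt ((x\<^sup>2 + d) / m)"
    have y: "m * ?y\<^sup>2 = x\<^sup>2 + d" using m d by simp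
    show "x \<in> f ` S \<union> (\<lambda>x. - x) ` f ` S \<union> {0}"
    proof (cases "x = 0")
      case False
      then have "?y \<in> S" unfolding S_def mem_Collect_eq y using x by auto
      moreover have "f ?y = \<bar>x\<bar>" unfolding f_def y by simp
      ultimately have "\<bar>x\<bar> \<in> f ` S" by (metis imageI)
      then show ?thesis by (cases "0 \<le> x") (force simp: image_iff)+
    qed simp
  qed
  ultimately have "negligible {x. sqrt ((x\<^sup>2 + d) / m) \<in> A}"
    by (rule negligible_subset)
  moreover have "{x. sqrt ((x\<^sup>2 + d) / m) \<in> A} \<in> sets borel"
    using measurable_sets[of "\<lambda>x. sqrt ((x\<^sup>2 + d) / m)" borel borel A] A' by (simp add: vimage_def)
  ultimately show ?thesis
    by (simp add: negligible_iff_null_sets null_sets_completion_iff)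
qed

text \<open>
  By Fubini's theorem it suffices to vary the coordinate 0 with the others fixed; these enter through the sum \<open>d\<close>
  of their squares only.
\<close>

lemma absolutely_continuous_chi_law:
  assumes m: "0 < m"
  shows "absolutely_continuous lborel (chi_law m)"
  unfolding absolutely_continuous_def
proof
  fix A :: "real set" assume A: "A \<in> null_sets lborel"
  then have [measurable]: "A \<in> sets borel" by auto
  interpret product_sigma_finite "\<lambda>_ :: nat. std_normal"
    by unfold_locales (use prob_space_std_normal in \<open>auto simp: prob_space_def finite_measure_def sigma_finite_measure_def\<close>)
  define I where "I = {1..<m}"
  have I: "{..<m} = insert 0 I" "finite I" "0 \<notin> I" using m by (auto simp: I_def)
  define h where "h x = sqrt ((\<Sum>j<m. (x j)\<^sup>2) / m)" for x :: "nat \<Rightarrow> real"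
  have hm: "h \<in> borel_measurable (std_gauss m)" unfolding h_def by measurable
  have "emeasure (chi_law m) A = (\<integral>\<^sup>+ x. indicator A x \<partial>chi_law m)"
    by (simp add: sets_chi_law)
  also have "\<dots> = (\<integral>\<^sup>+ x. indicator A (h x) \<partial>std_gauss m)"
    unfolding chi_law_std_gauss h_def[symmetric] by (rule nn_integral_distr[OF hm]) simp
  also have "\<dots> = (\<integral>\<^sup>+ x. \<integral>\<^sup>+ y. indicator A (h (x(0 := y))) \<partial>std_normal \<partial>PiM I (\<lambda>_. std_normal))"
    unfolding std_gauss_def I(1)
  proof (rule product_nn_integral_insert[OF I(2,3)])
    have "(\<lambda>x. indicator A (h x) :: ennreal) \<in> borel_measurable (std_gauss m)"
      by (rule measurable_compose[OF hm]) simp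
    then show "(\<lambda>x. indicator A (h x) :: ennreal) \<in> borel_measurable (PiM (insert 0 I) (\<lambda>_. std_normal))"
      by (simp add: std_gauss_def I(1))
  qed
  also have "\<dots> = (\<integral>\<^sup>+ x. 0 \<partial>PiM I (\<lambda>_. std_normal))"
  proof (rule nn_integral_cong)
    fix x :: "nat \<Rightarrow> real"
    define d where "d = (\<Sum>j\<in>I. (x j)\<^sup>2)"
    have h: "h (x(0 := y)) = sqrt ((y\<^sup>2 + d) / m)" for y
      using I unfolding h_def d_def I(1) by (auto intro!: arg_cong[where f = sqrt] sum.cong)
    have "{y. sqrt ((y\<^sup>2 + d) / m) \<in> A} \<in> null_sets lborel"
      using A m by (intro null_sets_preimage_norm) (auto simp: d_def sum_nonneg)
    then have "AE y in lborel. sqrt ((y\<^sup>2 + d) / m) \<notin> A"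
      by (auto intro: AE_I')
    then have "(\<integral>\<^sup>+ y. ennreal (std_normal_density y) * indicator A (sqrt ((y\<^sup>2 + d) / m)) \<partial>lborel) = (\<integral>\<^sup>+ (y :: real). 0 \<partial>lborel)"
      by (intro nn_integral_cong_AE) auto
    then show "(\<integral>\<^sup>+ y. indicator A (h (x(0 := y))) \<partial>std_normal) = 0"
      by (simp add: h nn_integral_density)
  qed
  finally show "A \<in> null_sets (chi_law m)"
    by (auto simp: null_sets_def sets_chi_law)
qed

lemma borel_measurable_rho [measurable]: "rho m \<in> borel_measurable borel"
  unfolding rho_def[abs_def] by measurable

lemma AE_chi_law_nonneg: "AE s in chi_law m. 0 \<le> s"
  unfolding chi_law_std_gauss by (subst AE_distr_iff) (auto intro!: AE_I2 sum_nonneg divide_nonneg_nonneg)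

text \<open>
  The Radon-Nikodym derivative is finite almost everywhere, and it vanishes almost everywhere on the
  negative half-line because \<open>chi_law m\<close> lives on the nonnegative one. So the two
  modifications made in \<open>rho\<close> do not change the measure.
\<close>

lemma chi_law_density:
  assumes m: "0 < m"
  shows "chi_law m = density lborel (\<lambda>s. ennreal (rho m s))"
proof -
  interpret P: prob_space "chi_law m" by (rule prob_space_chi_law)
  define D where "D = RN_deriv lborel (chi_law m)"
  have [measurable]: "D \<in> borel_measurable borel" unfolding D_def by measurable
  have dens: "density lborel D = chi_law m"
    unfolding D_def
    by (rule sigma_finite_measure.density_RN_deriv[OF sigma_finite_lborel absolutely_continuous_chi_law[OF m]])
       (simp add: sets_chi_law)
  have fin: "AE s in lborel. D s \<noteq> \<infinity>"
    unfolding D_def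
    using sigma_finite_measure.RN_deriv_finite[OF sigma_finite_lborel P.sigma_finite_measure_axioms absolutely_continuous_chi_law[OF m]]
    by (simp add: sets_chi_law)
  have "AE s in density lborel D. 0 \<le> s" unfolding dens by (rule AE_chi_law_nonneg)
  then have pos: "AE s in lborel. 0 < D s \<longrightarrow> 0 \<le> s" by (simp add: AE_density)
  have "AE s in lborel. D s = ennreal (rho m s)"
    using fin pos
  proof eventually_elim
    case (elim s)
    have "rho m s = (if s < 0 then 0 else enn2real (D s))"
      by (simp add: rho_def D_def chi_law_def)
    then show ?case using elim by (cases "s < 0") (auto simp: ennreal_enn2real_if not_less zero_less_iff_neq_zero)
  qed
  then have "density lborel D = density lborel (\<lambda>s. ennreal (rho m s))"
    by (intro density_cong) auto
  then show ?thesis using dens by simp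
qed

lemma emeasure_chi_law:
  assumes "0 < m" "A \<in> sets borel"
  shows "emeasure (chi_law m) A = (\<integral>\<^sup>+ s. ennreal (rho m s) * indicator A s \<partial>lborel)"
  unfolding chi_law_density[OF assms(1)] using assms by (intro emeasure_density) auto

lemma chi_law_tail:
  assumes e: "0 < e" and m: "0 < m"
  shows "measure (chi_law m) {s. e \<le> \<bar>s\<^sup>2 - 1\<bar>} \<le> 2 / (m * e\<^sup>2)"
proof -
  have "measure (chi_law m) {s. e \<le> \<bar>s\<^sup>2 - 1\<bar>}
      = measure (std_gauss m) {x \<in> space (std_gauss m). e \<le> \<bar>(sqrt ((\<Sum>j<m. (x j)\<^sup>2) / m))\<^sup>2 - 1\<bar>}"
    unfolding chi_law_std_gauss
    by (subst measure_distr) (auto intro!: arg_cong[where f = "measure (std_gauss m)"])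
  also have "\<dots> = measure (std_gauss m) {x \<in> space (std_gauss m). e \<le> \<bar>(\<Sum>j<m. (x j)\<^sup>2) / m - 1\<bar>}"
    by (simp add: sum_nonneg)
  also have "\<dots> \<le> 2 / (m * e\<^sup>2)" by (rule chi_square_tail[OF e m])
  finally show ?thesis .
qed

lemma tail_of_chi_law:
  assumes "R \<in> borel_measurable P" "distr P borel R = chi_law m" "0 < e" "0 < m"
  shows "measure P {x \<in> space P. e \<le> \<bar>(R x)\<^sup>2 - 1\<bar>} \<le> 2 / (m * e\<^sup>2)"
proof -
  have "measure P {x \<in> space P. e \<le> \<bar>(R x)\<^sup>2 - 1\<bar>} = measure (distr P borel R) {s. e \<le> \<bar>s\<^sup>2 - 1\<bar>}"
    using assms(1) by (subst measure_distr) (auto intro!: arg_cong[where f = "measure P"])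
  then show ?thesis using chi_law_tail[OF assms(3,4)] assms(2) by simp
qed

section \<open>The limit distribution as a law of the shrinkage map\<close>

definition shrink_law :: "nat \<Rightarrow> ereal \<Rightarrow> real measure"
  where "shrink_law m \<zeta> = distr (chi_law m) borel (shrink \<zeta>)"

lemma real_distribution_shrink_law: "real_distribution (shrink_law m \<zeta>)"
  unfolding shrink_law_def
  by (intro prob_space.real_distribution_distr[OF prob_space_chi_law]) measurable

text \<open>
  The event \<open>\<bar>\<zeta>\<bar> \<le> s\<close> is mapped to the point \<open>- \<zeta>\<close>. On its complement the map is
  \<open>s \<mapsto> - sgn \<zeta> \<cdot> s\<close>, whose image law has the density \<open>soft_ac_part\<close>; for \<open>\<zeta> > 0\<close> this involves a
  reflection of the line. For \<open>\<zeta> = 0\<close> there is only the atom.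
\<close>

lemma emeasure_shrink_law:
  assumes m: "0 < m" and A [measurable]: "A \<in> sets borel"
  shows "emeasure (shrink_law m \<zeta>) A =
    (\<integral>\<^sup>+ s \<in> {s. \<bar>\<zeta>\<bar> \<le> ereal s}. ennreal (rho m s) \<partial>lborel) * indicator A (real_of_ereal (- \<zeta>))
    + (\<integral>\<^sup>+ x \<in> A. ennreal (soft_ac_part m \<zeta> x) \<partial>lborel)"
proof -
  have "emeasure (shrink_law m \<zeta>) A = emeasure (chi_law m) {s. shrink \<zeta> s \<in> A}"
    unfolding shrink_law_def by (subst emeasure_distr) (auto simp: space_chi_law vimage_def)
  also have "\<dots> = (\<integral>\<^sup>+ s. ennreal (rho m s) * indicator A (shrink \<zeta> s) \<partial>lborel)"
    using m by (subst emeasure_chi_law) (auto intro!: nn_integral_cong simp: indicator_def)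
  also have "\<dots> = (\<integral>\<^sup>+ s. ennreal (rho m s) * indicator {s. \<bar>\<zeta>\<bar> \<le> ereal s} s * indicator A (real_of_ereal (- \<zeta>))
      + ennreal (rho m s * of_bool (ereal s < \<bar>\<zeta>\<bar>)) * indicator A (- real_of_ereal (sgn \<zeta>) * s) \<partial>lborel)"
  proof (rule nn_integral_cong)
    fix s
    show "ennreal (rho m s) * indicator A (shrink \<zeta> s) =
      ennreal (rho m s) * indicator {s. \<bar>\<zeta>\<bar> \<le> ereal s} s * indicator A (real_of_ereal (- \<zeta>))
      + ennreal (rho m s * of_bool (ereal s < \<bar>\<zeta>\<bar>)) * indicator A (- real_of_ereal (sgn \<zeta>) * s)"
    proof (cases "s < 0")
      case True
      then show ?thesis by (simp add: rho_def)
    next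
      case False
      then show ?thesis
        by (cases \<zeta>) (auto simp: shrink_simps min_def sgn_if indicator_def not_le)
    qed
  qed
  also have "\<dots> = (\<integral>\<^sup>+ s \<in> {s. \<bar>\<zeta>\<bar> \<le> ereal s}. ennreal (rho m s) \<partial>lborel) * indicator A (real_of_ereal (- \<zeta>))
    + (\<integral>\<^sup>+ s. ennreal (rho m s * of_bool (ereal s < \<bar>\<zeta>\<bar>)) * indicator A (- real_of_ereal (sgn \<zeta>) * s) \<partial>lborel)"
    by (subst nn_integral_add) (auto simp: nn_integral_multc)
  also have "(\<integral>\<^sup>+ s. ennreal (rho m s * of_bool (ereal s < \<bar>\<zeta>\<bar>)) * indicator A (- real_of_ereal (sgn \<zeta>) * s) \<partial>lborel)
    = (\<integral>\<^sup>+ x. ennreal (soft_ac_part m \<zeta> x) * indicator A x \<partial>lborel)"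
  proof -
    consider "\<zeta> = 0" | "0 < \<zeta>" | "\<zeta> < 0" by (meson linorder_neqE)
    then show ?thesis
    proof cases
      case 1
      have z: "rho m s * of_bool (ereal s < \<bar>\<zeta>\<bar>) = 0" "soft_ac_part m \<zeta> s = 0" for s
        using 1 by (auto simp: rho_def soft_ac_part_def)
      show ?thesis unfolding z by simp
    next
      case 2
      then have sg: "real_of_ereal (sgn \<zeta>) = 1" by (cases \<zeta>) auto
      have f: "rho m s * of_bool (ereal s < \<bar>\<zeta>\<bar>) = soft_ac_part m \<zeta> (- s)" for s
        using 2 by (cases \<zeta>) (auto simp: rho_def soft_ac_part_def)
      have "(\<integral>\<^sup>+ x. ennreal (soft_ac_part m \<zeta> x) * indicator A x \<partial>lborel)
         = ennreal \<bar>- 1\<bar> * (\<integral>\<^sup>+ x. ennreal (soft_ac_part m \<zeta> (0 + (- 1) * x)) * indicator A (0 + (- 1) * x) \<partial>lborel)"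
        by (rule nn_integral_real_affine) (auto simp: soft_ac_part_def[abs_def])
      then show ?thesis using sg by (simp add: f)
    next
      case 3
      then have sg: "real_of_ereal (sgn \<zeta>) = - 1" by (cases \<zeta>) auto
      have f: "rho m s * of_bool (ereal s < \<bar>\<zeta>\<bar>) = soft_ac_part m \<zeta> s" for s
        using 3 by (cases \<zeta>) (auto simp: rho_def soft_ac_part_def)
      then show ?thesis using sg by simp
    qed
  qed
  finally show ?thesis .
qed

text \<open>
  The set function in \<open>soft_limit\<close> agrees on the Borel sets with a measure, so it is countably
  additive and defines that measure.
\<close>

lemma soft_limit_eq_shrink_law:
  assumes m: "0 < m"
  shows "soft_limit m \<zeta> = shrink_law m \<zeta>"
proof -
  have "soft_limit m \<zeta> = measure_of UNIV (sets borel) (emeasure (shrink_law m \<zeta>))"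
    unfolding soft_limit_def atom_plus_density_def
    using sets.space_closed[of borel] by (intro measure_of_eq) (auto simp: sets.sigma_sets_eq[of borel, simplified] emeasure_shrink_law[OF m])
  then show ?thesis
    using measure_of_of_measure[of "shrink_law m \<zeta>"] by (simp add: shrink_law_def)
qed

text \<open>
  The integral is taken over a closed half-line, whereas the chi-square probability is that of an open one. They agree because
  an absolutely continuous law has no atoms.
\<close>

lemma soft_limit_atom_weight:
  assumes m: "0 < m"
  shows "(\<integral>\<^sup>+ s \<in> {s. \<bar>\<zeta>\<bar> \<le> ereal s}. ennreal (rho m s) \<partial>lborel)
    = emeasure (chi_square m) {x. ereal x > ereal (real m) * \<zeta>\<^sup>2}"
proof (cases \<zeta>)
  case (real z)
  interpret prob_space "chi_square m" by (rule prob_space_chi_square)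
  let ?g = "\<lambda>x. sqrt x / sqrt (real m)"
  have pre: "emeasure (chi_law m) B = emeasure (chi_square m) {x. ?g x \<in> B}" if "B \<in> sets borel" for B
    unfolding chi_law_def using that sets_eq_imp_space_eq[OF sets_chi_square]
    by (subst emeasure_distr) (auto simp: vimage_def)
  have pt: "AE x in chi_square m. x \<noteq> m * z\<^sup>2"
  proof (rule AE_I)
    have "emeasure (chi_square m) {m * z\<^sup>2} \<le> emeasure (chi_square m) {x. ?g x \<in> {?g (m * z\<^sup>2)}}"
      by (intro emeasure_mono) (auto simp: sets_chi_square)
    also have "\<dots> = emeasure (chi_law m) {?g (m * z\<^sup>2)}" by (rule pre[symmetric]) simp
    also have "\<dots> = 0"
      using subsetD[OF absolutely_continuous_chi_law[OF m, unfolded absolutely_continuous_def], of "{?g (m * z\<^sup>2)}"]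
      by (auto simp: null_sets_def)
    finally show "emeasure (chi_square m) {m * z\<^sup>2} = 0" by simp
  qed (auto simp: sets_chi_square)
  have "(\<integral>\<^sup>+ s \<in> {s. \<bar>\<zeta>\<bar> \<le> ereal s}. ennreal (rho m s) \<partial>lborel) = emeasure (chi_law m) {s. \<bar>z\<bar> \<le> s}"
    using m by (simp add: emeasure_chi_law real)
  also have "\<dots> = emeasure (chi_square m) {x. \<bar>z\<bar> \<le> ?g x}"
    by (subst pre) auto
  also have "{x. \<bar>z\<bar> \<le> ?g x} = {x. m * z\<^sup>2 \<le> x}"
  proof -
    have "\<bar>z\<bar> \<le> ?g x \<longleftrightarrow> sqrt (m * z\<^sup>2) \<le> sqrt x" for x
      using m by (simp add: real_sqrt_mult pos_le_divide_eq mult.commute)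
    then show ?thesis by simp
  qed
  also have "emeasure (chi_square m) {x. m * z\<^sup>2 \<le> x} = emeasure (chi_square m) {x. m * z\<^sup>2 < x}"
    using pt by (intro emeasure_eq_AE) (auto simp: sets_chi_square)
  also have "{x. m * z\<^sup>2 < x} = {x. ereal x > ereal (real m) * \<zeta>\<^sup>2}"
    by (simp add: real)
  finally show ?thesis .
qed (use m in \<open>auto simp: power2_eq_square\<close>)

lemma soft_limit_infinite:
  assumes m: "0 < m" and \<zeta>: "\<bar>\<zeta>\<bar> = \<infinity>"
  shows "soft_limit m \<zeta> = density lborel (\<lambda>x. ennreal (rho m (- real_of_ereal (sgn \<zeta>) * x)))"
proof -
  have ac: "soft_ac_part m \<zeta> x = rho m (- real_of_ereal (sgn \<zeta>) * x)" for x
    using \<zeta> by (cases \<zeta>) (auto simp: soft_ac_part_def)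
  have none: "{s. \<bar>\<zeta>\<bar> \<le> ereal s} = {}" using \<zeta> by auto
  show ?thesis
    unfolding soft_limit_eq_shrink_law[OF m]
    by (rule measure_eqI)
       (auto simp: shrink_law_def emeasure_shrink_law[OF m, unfolded shrink_law_def] none ac emeasure_density)
qed

section \<open>Weak convergence of thresholded sequences\<close>

text \<open>
  A version of Slutsky's lemma for sequences whose comparison variables \<open>D n\<close> all have the limit
  law \<open>L\<close>. The probability spaces may vary with \<open>n\<close>, and the argument is the usual one: up to the
  probability of \<open>d' \<le> \<bar>A - D\<bar>\<close>, the event \<open>A \<le> x\<close> lies between \<open>D \<le> x - d'\<close> and \<open>D \<le> x + d'\<close>.
\<close>

lemma weak_conv_cdf_of_close:
  fixes P :: "nat \<Rightarrow> 'a measure" and A D :: "nat \<Rightarrow> 'a \<Rightarrow> real"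
  assumes P: "eventually (\<lambda>n. prob_space (P n)) sequentially"
    and A: "eventually (\<lambda>n. A n \<in> borel_measurable (P n)) sequentially"
    and D: "eventually (\<lambda>n. D n \<in> borel_measurable (P n)) sequentially"
    and L: "eventually (\<lambda>n. distr (P n) borel (D n) = L) sequentially"
    and H: "eventually (\<lambda>n. H n = cdf (distr (P n) borel (A n))) sequentially"
    and close: "\<And>e. 0 < e \<Longrightarrow>
      (\<lambda>n. measure (P n) {x \<in> space (P n). e \<le> \<bar>A n x - D n x\<bar>}) \<longlonglongrightarrow> 0"
  shows "weak_conv H (cdf L)"
  unfolding weak_conv_def
proof (intro allI impI)
  fix x assume cont: "isCont (cdf L) x"
  show "(\<lambda>n. H n x) \<longlonglongrightarrow> cdf L x"
  proof (rule tendstoI)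
    fix e :: real assume "0 < e"
    then obtain d where d: "0 < d" and dx: "\<And>y. dist y x < d \<Longrightarrow> dist (cdf L y) (cdf L x) < e / 2"
      using cont by (metis continuous_at_eps_delta half_gt_zero)
    define d' where "d' = d / 2"
    have d': "0 < d'" and up: "cdf L (x + d') < cdf L x + e / 2" and lo: "cdf L x - e / 2 < cdf L (x - d')"
      using d dx[of "x + d'"] dx[of "x - d'"] by (auto simp: d'_def dist_real_def abs_if split: if_splits)
    have "eventually (\<lambda>n. measure (P n) {x \<in> space (P n). d' \<le> \<bar>A n x - D n x\<bar>} < e / 2) sequentially"
      using close[OF d'] \<open>0 < e\<close> by (intro order_tendstoD(2)) auto
    with P A D L H show "eventually (\<lambda>n. dist (H n x) (cdf L x) < e) sequentially"
    proof eventually_elim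
      case (elim n)
      interpret prob_space "P n" by fact
      note [measurable] = elim(2,3)
      let ?B = "{\<omega> \<in> space (P n). d' \<le> \<bar>A n \<omega> - D n \<omega>\<bar>}"
      have HA: "H n x = prob {\<omega> \<in> space (P n). A n \<omega> \<le> x}"
        by (auto simp: elim cdf_def measure_distr intro!: arg_cong[where f = prob])
      have LD: "cdf L y = prob {\<omega> \<in> space (P n). D n \<omega> \<le> y}" for y
        by (auto simp: elim(4)[symmetric] cdf_def measure_distr intro!: arg_cong[where f = prob])
      have "H n x \<le> prob ({\<omega> \<in> space (P n). D n \<omega> \<le> x + d'} \<union> ?B)"
        unfolding HA by (rule finite_measure_mono) (auto simp: abs_if split: if_splits)
      also have "\<dots> \<le> cdf L (x + d') + prob ?B"
        unfolding LD by (rule measure_subadditive) auto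
      finally have 1: "H n x < cdf L x + e" using up elim(6) by linarith
      have "cdf L (x - d') \<le> prob ({\<omega> \<in> space (P n). A n \<omega> \<le> x} \<union> ?B)"
        unfolding LD by (rule finite_measure_mono) (auto simp: abs_if split: if_splits)
      also have "\<dots> \<le> H n x + prob ?B"
        unfolding HA by (rule measure_subadditive) auto
      finally have 2: "cdf L x - e < H n x" using lo elim(6) by linarith
      show ?case using 1 2 by (simp add: dist_real_def abs_if)
    qed
  qed
qed

text \<open>
  The regression model enters the asymptotics through these properties only: \<open>Z\<close> is the normalized
  estimation error, \<open>R\<close> the normalized standard deviation estimate and \<open>t\<close> the normalized parameter.
\<close>

locale thresholded_sequence =
  fixes P :: "nat \<Rightarrow> 'a measure" and Z R :: "nat \<Rightarrow> 'a \<Rightarrow> real" and m :: "nat \<Rightarrow> nat"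
    and t :: "nat \<Rightarrow> real" and \<zeta> :: ereal and A :: "nat \<Rightarrow> 'a \<Rightarrow> real"
  assumes P: "eventually (\<lambda>n. prob_space (P n)) sequentially"
    and Zm: "eventually (\<lambda>n. Z n \<in> borel_measurable (P n)) sequentially"
    and Rm: "eventually (\<lambda>n. R n \<in> borel_measurable (P n)) sequentially"
    and R0: "eventually (\<lambda>n. \<forall>x\<in>space (P n). 0 \<le> R n x) sequentially"
    and R_law: "eventually (\<lambda>n. distr (P n) borel (R n) = chi_law (m n)) sequentially"
    and m: "eventually (\<lambda>n. 0 < m n) sequentially"
    and Z: "\<And>e. 0 < e \<Longrightarrow> (\<lambda>n. measure (P n) {x \<in> space (P n). e \<le> \<bar>Z n x\<bar>}) \<longlonglongrightarrow> 0"
    and t: "(\<lambda>n. ereal (t n)) \<longlonglongrightarrow> \<zeta>"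
    and A: "eventually (\<lambda>n. \<forall>x\<in>space (P n). A n x = Z n x + shrink (ereal (t n + Z n x)) (R n x)) sequentially"
begin

lemma A_measurable: "eventually (\<lambda>n. A n \<in> borel_measurable (P n)) sequentially"
  using A Zm Rm
proof eventually_elim
  case (elim n)
  note [measurable] = elim(2,3)
  have "(\<lambda>x. Z n x + shrink (ereal (t n + Z n x)) (R n x)) \<in> borel_measurable (P n)"
    unfolding shrink_simps sgn_if by measurable
  then show ?case using elim(1) by (subst measurable_cong) auto
qed

text \<open>
  Replacing \<open>t + Z\<close> by \<open>t\<close> costs at most \<open>\<bar>Z\<bar>\<close>, and replacing \<open>t\<close> by \<open>\<zeta>\<close> costs little uniformly
  for bounded \<open>R\<close>. Large values of \<open>R\<close> are unlikely uniformly in \<open>n\<close>, as \<open>R\<^sup>2\<close> has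
  mean 1 and variance at most 2.
\<close>

lemma close_to_shrink:
  assumes e: "0 < e"
  shows "(\<lambda>n. measure (P n) {x \<in> space (P n). e \<le> \<bar>A n x - shrink \<zeta> (R n x)\<bar>}) \<longlonglongrightarrow> 0"
proof (rule tendstoI)
  fix d :: real assume d: "0 < d"
  \<comment> \<open>large enough for the tail bound \<open>2 / b\<^sup>2\<close> of \<open>R\<^sup>2 - 1\<close> to be below \<open>d / 2\<close>\<close>
  define b where "b = 4 / d + 1"
  have b: "1 < b" "2 / b\<^sup>2 < d / 2"
  proof -
    show 1: "1 < b" using d by (simp add: b_def)
    have "4 / d < b" by (simp add: b_def)
    also have "b \<le> b\<^sup>2" using 1 by (simp add: power2_eq_square)
    finally show "2 / b\<^sup>2 < d / 2" using d 1 by (simp add: field_simps)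
  qed
  have Z': "eventually (\<lambda>n. measure (P n) {x \<in> space (P n). e / 3 \<le> \<bar>Z n x\<bar>} < d / 2) sequentially"
    using Z[of "e / 3"] e d by (intro order_tendstoD(2)) auto
  have S: "eventually (\<lambda>n. \<forall>r. 0 \<le> r \<and> r \<le> 1 + b \<longrightarrow> \<bar>shrink (ereal (t n)) r - shrink \<zeta> r\<bar> < e / 3) sequentially"
    using e by (intro shrink_eventually[OF t]) simp
  show "eventually (\<lambda>n. dist (measure (P n) {x \<in> space (P n). e \<le> \<bar>A n x - shrink \<zeta> (R n x)\<bar>}) 0 < d) sequentially"
    using P Zm Rm R0 R_law m A Z' S
  proof eventually_elim
    case (elim n)
    interpret prob_space "P n" by fact
    note [measurable] = elim(2,3)
    let ?Z = "{x \<in> space (P n). e / 3 \<le> \<bar>Z n x\<bar>}" and ?R = "{x \<in> space (P n). b \<le> \<bar>(R n x)\<^sup>2 - 1\<bar>}"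
    have "{x \<in> space (P n). e \<le> \<bar>A n x - shrink \<zeta> (R n x)\<bar>} \<subseteq> ?Z \<union> ?R"
    proof
      fix x assume x: "x \<in> {x \<in> space (P n). e \<le> \<bar>A n x - shrink \<zeta> (R n x)\<bar>}"
      show "x \<in> ?Z \<union> ?R"
      proof (rule ccontr)
        assume "x \<notin> ?Z \<union> ?R"
        then have z: "\<bar>Z n x\<bar> < e / 3" and r: "\<bar>(R n x)\<^sup>2 - 1\<bar> < b" using x by auto
        have r0: "0 \<le> R n x" using elim(4) x by auto
        have "(R n x)\<^sup>2 \<le> (1 + b)\<^sup>2"
        proof -
          have "(R n x)\<^sup>2 < 1 + b" using r by linarith
          also have "\<dots> \<le> (1 + b)\<^sup>2" using b by (simp add: power2_eq_square)
          finally show ?thesis by simp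
        qed
        then have "R n x \<le> 1 + b" using b by (simp add: power2_le_iff_abs_le)
        then have "\<bar>shrink (ereal (t n)) (R n x) - shrink \<zeta> (R n x)\<bar> < e / 3" using elim(9) r0 by blast
        moreover have "\<bar>shrink (ereal (t n + Z n x)) (R n x) - shrink (ereal (t n)) (R n x)\<bar> \<le> \<bar>Z n x\<bar>"
          using shrink_lipschitz_ereal[OF r0, of "t n + Z n x" "t n"] by simp
        moreover have "A n x = Z n x + shrink (ereal (t n + Z n x)) (R n x)" using elim(7) x by blast
        ultimately have "\<bar>A n x - shrink \<zeta> (R n x)\<bar> < e" using z by linarith
        then show False using x by simp
      qed
    qed
    then have "prob {x \<in> space (P n). e \<le> \<bar>A n x - shrink \<zeta> (R n x)\<bar>} \<le> prob (?Z \<union> ?R)"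
      by (intro finite_measure_mono) auto
    also have "\<dots> \<le> prob ?Z + prob ?R" by (intro measure_subadditive) auto
    also have "prob ?R \<le> 2 / (m n * b\<^sup>2)" using b elim by (intro tail_of_chi_law) auto
    also have "\<dots> \<le> 2 / b\<^sup>2" using b elim(6) by (intro divide_left_mono) auto
    finally show ?case using b elim(8) by simp
  qed
qed

lemma weak_conv_fixed_df:
  assumes m0: "eventually (\<lambda>n. m n = m0) sequentially"
    and H: "eventually (\<lambda>n. H n = cdf (distr (P n) borel (A n))) sequentially"
  shows "weak_conv H (cdf (shrink_law m0 \<zeta>))"
proof (rule weak_conv_cdf_of_close[where D = "\<lambda>n x. shrink \<zeta> (R n x)", OF P A_measurable _ _ H close_to_shrink])
  show "eventually (\<lambda>n. (\<lambda>x. shrink \<zeta> (R n x)) \<in> borel_measurable (P n)) sequentially"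
    using Rm by eventually_elim measurable
  show "eventually (\<lambda>n. distr (P n) borel (\<lambda>x. shrink \<zeta> (R n x)) = shrink_law m0 \<zeta>) sequentially"
    using Rm R_law m0
  proof eventually_elim
    case (elim n)
    then have "shrink_law m0 \<zeta> = distr (distr (P n) borel (R n)) borel (shrink \<zeta>)"
      by (simp add: shrink_law_def)
    also have "\<dots> = distr (P n) borel (shrink \<zeta> \<circ> R n)"
      using elim(1) by (intro distr_distr) auto
    finally show ?case by (simp add: comp_def)
  qed
qed

text \<open>
  Here \<open>shrink \<zeta> R\<close> is itself close to a constant, since \<open>\<bar>R - 1\<bar> \<le> \<bar>R\<^sup>2 - 1\<bar>\<close> for \<open>0 \<le> R\<close>.
\<close>

lemma weak_conv_diverging_df:
  assumes m_top: "filterlim m at_top sequentially"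
    and H: "eventually (\<lambda>n. H n = cdf (distr (P n) borel (A n))) sequentially"
  shows "weak_conv H (cdf (return borel (shrink \<zeta> 1)))"
proof (rule weak_conv_cdf_of_close[where D = "\<lambda>n x. shrink \<zeta> 1", OF P A_measurable _ _ H])
  show "eventually (\<lambda>n. distr (P n) borel (\<lambda>x. shrink \<zeta> 1) = return borel (shrink \<zeta> 1)) sequentially"
    using P by eventually_elim (simp add: prob_space.distr_const)
  fix e :: real assume e: "0 < e"
  have "(\<lambda>n. 2 / (e / 2)\<^sup>2 * inverse (real (m n))) \<longlonglongrightarrow> 2 / (e / 2)\<^sup>2 * 0"
    by (intro tendsto_mult tendsto_const tendsto_inverse_0_at_top
        filterlim_compose[OF filterlim_real_sequentially m_top])
  then have "(\<lambda>n. measure (P n) {x \<in> space (P n). e / 2 \<le> \<bar>A n x - shrink \<zeta> (R n x)\<bar>}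
      + 2 / (e / 2)\<^sup>2 * inverse (real (m n))) \<longlonglongrightarrow> 0"
    using tendsto_add[OF close_to_shrink[of "e / 2"]] e by fastforce
  then show "(\<lambda>n. measure (P n) {x \<in> space (P n). e \<le> \<bar>A n x - shrink \<zeta> 1\<bar>}) \<longlonglongrightarrow> 0"
  proof (rule Lim_null_comparison[rotated])
    show "eventually (\<lambda>n. norm (measure (P n) {x \<in> space (P n). e \<le> \<bar>A n x - shrink \<zeta> 1\<bar>})
      \<le> measure (P n) {x \<in> space (P n). e / 2 \<le> \<bar>A n x - shrink \<zeta> (R n x)\<bar>}
      + 2 / (e / 2)\<^sup>2 * inverse (real (m n))) sequentially"
      using P A_measurable Rm R0 R_law m
    proof eventually_elim
      case (elim n)
      interpret prob_space "P n" by fact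
      note [measurable] = elim(2,3)
      let ?A = "{x \<in> space (P n). e / 2 \<le> \<bar>A n x - shrink \<zeta> (R n x)\<bar>}"
      let ?R = "{x \<in> space (P n). e / 2 \<le> \<bar>(R n x)\<^sup>2 - 1\<bar>}"
      have "{x \<in> space (P n). e \<le> \<bar>A n x - shrink \<zeta> 1\<bar>} \<subseteq> ?A \<union> ?R"
      proof
        fix x assume x: "x \<in> {x \<in> space (P n). e \<le> \<bar>A n x - shrink \<zeta> 1\<bar>}"
        have "\<bar>R n x - 1\<bar> * 1 \<le> \<bar>R n x - 1\<bar> * \<bar>R n x + 1\<bar>"
          using elim(4) x by (intro mult_left_mono) auto
        also have "\<dots> = \<bar>(R n x)\<^sup>2 - 1\<bar>"
          by (simp add: abs_mult[symmetric] power2_eq_square algebra_simps)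
        finally have "\<bar>R n x - 1\<bar> \<le> \<bar>(R n x)\<^sup>2 - 1\<bar>" by simp
        then have "\<bar>shrink \<zeta> (R n x) - shrink \<zeta> 1\<bar> \<le> \<bar>(R n x)\<^sup>2 - 1\<bar>"
          by (rule order_trans[OF shrink_lipschitz_real])
        moreover have "\<bar>A n x - shrink \<zeta> 1\<bar>
            \<le> \<bar>A n x - shrink \<zeta> (R n x)\<bar> + \<bar>shrink \<zeta> (R n x) - shrink \<zeta> 1\<bar>"
          by linarith
        ultimately have sum: "e \<le> \<bar>A n x - shrink \<zeta> (R n x)\<bar> + \<bar>(R n x)\<^sup>2 - 1\<bar>"
          using x by simp
        have half: "e / 2 \<le> a \<or> e / 2 \<le> b" if "e \<le> a + b" for a b
          using that by linarith
        show "x \<in> ?A \<union> ?R" using half[OF sum] x by simp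
      qed
      then have "prob {x \<in> space (P n). e \<le> \<bar>A n x - shrink \<zeta> 1\<bar>} \<le> prob (?A \<union> ?R)"
        by (intro finite_measure_mono) auto
      also have "\<dots> \<le> prob ?A + prob ?R" by (intro measure_subadditive) auto
      also have "prob ?R \<le> 2 / (m n * (e / 2)\<^sup>2)" using e elim by (intro tail_of_chi_law) auto
      finally show ?case by (simp add: field_simps)
    qed
  qed
qed simp

end

section \<open>The scaled estimation error\<close>

lemma density_PiM_lborel:
  assumes f: "f \<in> borel_measurable borel" and I: "finite I" and p: "prob_space (density lborel f)"
  shows "density (PiM I (\<lambda>_. lborel)) (\<lambda>x. \<Prod>j\<in>I. f (x j)) = PiM I (\<lambda>_ :: 'i. density lborel f :: real measure)"
proof -
  interpret L: product_sigma_finite "\<lambda>_ :: 'i. lborel :: real measure"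
    by unfold_locales
  interpret D: product_sigma_finite "\<lambda>_ :: 'i. density lborel f :: real measure"
    by unfold_locales (use p in \<open>auto simp: prob_space_def finite_measure_def sigma_finite_measure_def\<close>)
  note [measurable] = f
  show ?thesis
  proof (rule D.PiM_eqI[OF I])
    show "sets (density (PiM I (\<lambda>_. lborel)) (\<lambda>x. \<Prod>j\<in>I. f (x j))) = sets (PiM I (\<lambda>_. density lborel f))"
      by (simp cong: sets_PiM_cong)
    fix B :: "'i \<Rightarrow> real set" assume "\<And>j. j \<in> I \<Longrightarrow> B j \<in> sets (density lborel f)"
    then have B: "\<And>j. j \<in> I \<Longrightarrow> B j \<in> sets borel" by simp
    have "emeasure (density (PiM I (\<lambda>_. lborel)) (\<lambda>x. \<Prod>j\<in>I. f (x j))) (Pi\<^sub>E I B)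
        = (\<integral>\<^sup>+ x. (\<Prod>j\<in>I. f (x j)) * indicator (Pi\<^sub>E I B) x \<partial>PiM I (\<lambda>_. lborel))"
      using B I by (intro emeasure_density) (auto intro!: sets_PiM_I_finite)
    also have "\<dots> = (\<integral>\<^sup>+ x. (\<Prod>j\<in>I. f (x j) * indicator (B j) (x j)) \<partial>PiM I (\<lambda>_. lborel))"
    proof (rule nn_integral_cong)
      fix x :: "'i \<Rightarrow> real" assume "x \<in> space (PiM I (\<lambda>_. lborel))"
      then have "indicator (Pi\<^sub>E I B) x = (\<Prod>j\<in>I. indicator (B j) (x j) :: ennreal)"
        using I by (auto simp: indicator_def space_PiM PiE_def Pi_def prod_zero_iff)
      then show "(\<Prod>j\<in>I. f (x j)) * indicator (Pi\<^sub>E I B) x = (\<Prod>j\<in>I. f (x j) * indicator (B j) (x j))"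
        by (simp add: prod.distrib)
    qed
    also have "\<dots> = (\<Prod>j\<in>I. \<integral>\<^sup>+ y. f y * indicator (B j) y \<partial>lborel)"
      using B I by (intro L.product_nn_integral_prod) auto
    also have "\<dots> = (\<Prod>j\<in>I. emeasure (density lborel f) (B j))"
      using B by (intro prod.cong) (auto simp: emeasure_density)
    finally show "emeasure (density (PiM I (\<lambda>_. lborel)) (\<lambda>x. \<Prod>j\<in>I. f (x j))) (Pi\<^sub>E I B)
        = (\<Prod>j\<in>I. emeasure (density lborel f) (B j))" .
  qed
qed

text \<open>
  The density of a spherical normal vector factorizes, so its coordinates are independent; dividing
  them by the common standard deviation yields the standard Gaussian measure.
\<close>

lemma standardized_spherical_normal:
  assumes u: "mvnormal M u (0\<^sub>v n) (s\<^sup>2 \<cdot>\<^sub>m 1\<^sub>m n)" and s: "0 < s"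
  defines "V \<equiv> \<lambda>\<omega>. \<lambda>j\<in>{..<n}. u \<omega> $ j / s"
  shows "V \<in> M \<rightarrow>\<^sub>M std_gauss n" "distr M (std_gauss n) V = std_gauss n"
proof -
  let ?N = "density lborel (\<lambda>x. ennreal (normal_density 0 s x))"
  let ?U = "\<lambda>\<omega>. \<lambda>j\<in>{..<n}. u \<omega> $ j"
  have dist: "distributed M (PiM {..<n} (\<lambda>_. lborel)) ?U (\<lambda>x. ennreal (\<Prod>j<n. normal_density 0 s (x j)))"
    using u by (simp add: mvnormal_def mvnormal_density_spherical[OF s])
  have pN: "prob_space ?N" by (rule prob_space_normal_density[OF s])
  have sets_b: "sets (PiM {..<n} (\<lambda>_ :: nat. lborel :: real measure)) = sets (PiM {..<n} (\<lambda>_. borel))"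
    "sets (PiM {..<n} (\<lambda>_. ?N)) = sets (PiM {..<n} (\<lambda>_. borel))"
    by (intro sets_PiM_cong; simp)+
  have Um: "?U \<in> M \<rightarrow>\<^sub>M PiM {..<n} (\<lambda>_. borel)"
    using dist unfolding distributed_def by (simp add: measurable_cong_sets[OF refl sets_b(1)])
  have "distr M (PiM {..<n} (\<lambda>_. borel)) ?U = distr M (PiM {..<n} (\<lambda>_. lborel)) ?U"
    by (intro distr_cong) (auto simp: sets_b)
  also have "\<dots> = density (PiM {..<n} (\<lambda>_. lborel)) (\<lambda>x. ennreal (\<Prod>j<n. normal_density 0 s (x j)))"
    using dist by (simp add: distributed_def)
  also have "\<dots> = PiM {..<n} (\<lambda>_. ?N)"
    using density_PiM_lborel[of "\<lambda>x. ennreal (normal_density 0 s x)" "{..<n}", OF _ _ pN]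
    by (simp add: prod_ennreal)
  finally have law: "distr M (PiM {..<n} (\<lambda>_. borel)) ?U = PiM {..<n} (\<lambda>_. ?N)" .
  have V: "V = compose {..<n} (\<lambda>x. x / s) \<circ> ?U"
    by (auto simp: V_def compose_def fun_eq_iff)
  have cm: "compose {..<n} (\<lambda>x. x / s) \<in> PiM {..<n} (\<lambda>_. borel) \<rightarrow>\<^sub>M PiM {..<n} (\<lambda>_. borel)"
    unfolding compose_def by measurable
  then have cm': "compose {..<n} (\<lambda>x. x / s) \<in> PiM {..<n} (\<lambda>_. borel) \<rightarrow>\<^sub>M std_gauss n"
    by (simp add: measurable_cong_sets[OF refl sets_std_gauss])
  show "V \<in> M \<rightarrow>\<^sub>M std_gauss n"
    unfolding V by (rule measurable_comp[OF Um cm'])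
  have one: "distr ?N std_normal (\<lambda>x. x / s) = std_normal"
  proof -
    have "distributed ?N lborel (\<lambda>x. x) (normal_density 0 s)"
      by (auto simp: distributed_def distr_id2 cong: distr_cong)
    then have "distributed ?N lborel (\<lambda>x. x / s) std_normal_density"
      using prob_space.normal_standard_normal_convert[OF pN s, of "\<lambda>x. x" 0] by simp
    then have "distr ?N lborel (\<lambda>x. x / s) = std_normal" by (simp add: distributed_def)
    moreover have "distr ?N std_normal (\<lambda>x. x / s) = distr ?N lborel (\<lambda>x. x / s)"
      by (intro distr_cong) auto
    ultimately show ?thesis by simp
  qed
  have "distr M (std_gauss n) V = distr (distr M (PiM {..<n} (\<lambda>_. borel)) ?U) (std_gauss n) (compose {..<n} (\<lambda>x. x / s))"
    unfolding V by (rule distr_distr[OF cm' Um, symmetric])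
  also have "\<dots> = PiM {..<n} (\<lambda>_. distr ?N std_normal (\<lambda>x. x / s))"
    unfolding law std_gauss_def
    by (intro distr_PiM_finite_prob_space') (auto simp: pN prob_space_std_normal)
  finally show "distr M (std_gauss n) V = std_gauss n"
    unfolding one std_gauss_def .
qed

context full_rank_design
begin

definition rss :: "(nat \<Rightarrow> real) \<Rightarrow> real"
  where "rss x = (vec n x - X *\<^sub>v (W *\<^sub>v vec n x)) \<bullet> (vec n x - X *\<^sub>v (W *\<^sub>v vec n x))"

lemma rss_nonneg: "0 \<le> rss x"
  by (auto simp: rss_def scalar_prod_def intro!: sum_nonneg)

lemma rss_measurable [measurable]: "rss \<in> borel_measurable (PiM {..<n} (\<lambda>_. borel))"
proof -
  define B where "B = X * W"
  have B: "B \<in> carrier_mat n n" using X W_carrier by (simp add: B_def)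
  have expand: "rss x = (\<Sum>r<n. (x r - (\<Sum>c<n. B $$ (r, c) * x c))\<^sup>2)" for x
  proof -
    have "X *\<^sub>v (W *\<^sub>v vec n x) = B *\<^sub>v vec n x"
      unfolding B_def using X W_carrier by (intro assoc_mult_mat_vec[symmetric]) auto
    moreover have "(B *\<^sub>v vec n x) $ r = (\<Sum>c<n. B $$ (r, c) * x c)" if "r < n" for r
      using B that by (auto simp: scalar_prod_def atLeast0LessThan intro!: sum.cong)
    ultimately show ?thesis
      using B by (simp add: rss_def scalar_prod_def[of "_ - _"] power2_eq_square atLeast0LessThan
          del: index_mult_mat_vec)
  qed
  show ?thesis unfolding expand[abs_def] by measurable
qed

text \<open>
  The exact identity behind the theorem. The variance of \<open>Z\<close> is \<open>1 / (n \<eta>\<^sup>2)\<close> because the squared norm of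
  row \<open>i\<close> of \<open>W\<close> is \<open>\<xi>\<^sup>2 / n\<close>.
\<close>

lemma scaled_error_representation:
  assumes i: "i < k" and \<eta>: "0 < \<eta>" and \<theta>: "\<theta> \<in> carrier_vec k" and \<sigma>: "0 < \<sigma>"
    and M: "prob_space M" and u: "mvnormal M u (0\<^sub>v n) (\<sigma>\<^sup>2 \<cdot>\<^sub>m 1\<^sub>m n)"
  shows "\<exists>Z R. Z \<in> borel_measurable M \<and> R \<in> borel_measurable M \<and> (\<forall>\<omega>\<in>space M. 0 \<le> R \<omega>) \<and>
    distr M borel R = chi_law (n - k) \<and>
    (\<forall>e>0. measure M {\<omega> \<in> space M. e \<le> \<bar>Z \<omega>\<bar>} \<le> 1 / (sqrt n * \<eta> * e)\<^sup>2) \<and>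
    (\<forall>\<omega>\<in>space M. inverse \<sigma> * inverse (xi X i * \<eta>) * (theta_soft X \<eta> i (X *\<^sub>v \<theta> + u \<omega>) - \<theta> $ i)
      = Z \<omega> + shrink (ereal (\<theta> $ i / (\<sigma> * xi X i * \<eta>) + Z \<omega>)) (R \<omega>))"
proof -
  define V where "V \<omega> = (\<lambda>j\<in>{..<n}. u \<omega> $ j / \<sigma>)" for \<omega>
  have Vm: "V \<in> M \<rightarrow>\<^sub>M std_gauss n" and Vd: "distr M (std_gauss n) V = std_gauss n"
    using standardized_spherical_normal[OF u \<sigma>] by (simp_all add: V_def[abs_def])
  define z where "z x = (\<Sum>j<n. W $$ (i, j) / (xi X i * \<eta>) * x j)" for x :: "nat \<Rightarrow> real"
  define r where "r x = sqrt (rss x) / sqrt (n - k)" for x :: "nat \<Rightarrow> real"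
  have [measurable]: "z \<in> borel_measurable (PiM {..<n} (\<lambda>_. borel))" unfolding z_def by measurable
  have [measurable]: "r \<in> borel_measurable (PiM {..<n} (\<lambda>_. borel))" unfolding r_def by measurable
  have zm: "z \<in> borel_measurable (std_gauss n)" and rm: "r \<in> borel_measurable (std_gauss n)" by measurable
  have n: "0 < n" using k by simp
  note xi = xi_square[OF i]
  have meas: "z \<circ> V \<in> borel_measurable M" "r \<circ> V \<in> borel_measurable M"
    using measurable_comp[OF Vm zm] measurable_comp[OF Vm rm] by auto
  have nonneg: "0 \<le> (r \<circ> V) \<omega>" for \<omega> using rss_nonneg by (simp add: r_def)
  have law: "distr M borel (r \<circ> V) = chi_law (n - k)"
  proof -
    have "distr M borel (r \<circ> V) = distr (std_gauss n) borel r"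
      using distr_distr[OF rm Vm] by (simp add: Vd)
    also have "\<dots> = distr (distr (std_gauss n) borel rss) borel (\<lambda>y. sqrt y / sqrt (n - k))"
      by (subst distr_distr) (auto simp: r_def[abs_def] comp_def)
    finally show ?thesis
      using residual_law by (simp add: rss_def[abs_def] chi_law_def)
  qed
  have tail: "measure M {\<omega> \<in> space M. e \<le> \<bar>(z \<circ> V) \<omega>\<bar>} \<le> 1 / (sqrt n * \<eta> * e)\<^sup>2" if e: "0 < e" for e
  proof -
    have "measure M {\<omega> \<in> space M. e \<le> \<bar>(z \<circ> V) \<omega>\<bar>}
       = measure (distr M (std_gauss n) V) {x \<in> space (std_gauss n). e \<le> \<bar>z x\<bar>}"
      using Vm measurable_space[OF Vm] by (subst measure_distr) (auto intro!: arg_cong[where f = "measure M"])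
    also have "\<dots> \<le> (\<Sum>j<n. (W $$ (i, j) / (xi X i * \<eta>))\<^sup>2) / e\<^sup>2"
      unfolding Vd z_def by (rule linear_form_tail[OF e])
    also have "(\<Sum>j<n. (W $$ (i, j) / (xi X i * \<eta>))\<^sup>2) = (\<Sum>j<n. (W $$ (i, j))\<^sup>2) / ((xi X i)\<^sup>2 * \<eta>\<^sup>2)"
      by (simp add: power_divide power_mult_distrib sum_divide_distrib)
    also have "\<dots> = 1 / (n * \<eta>\<^sup>2)"
      using W_row_nonzero[OF i] n by (simp add: xi(1))
    finally show ?thesis using n by (simp add: power_mult_distrib)
  qed
  have rep: "inverse \<sigma> * inverse (xi X i * \<eta>) * (theta_soft X \<eta> i (X *\<^sub>v \<theta> + u \<omega>) - \<theta> $ i)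
      = (z \<circ> V) \<omega> + shrink (ereal (\<theta> $ i / (\<sigma> * xi X i * \<eta>) + (z \<circ> V) \<omega>)) ((r \<circ> V) \<omega>)"
    if \<omega>: "\<omega> \<in> space M" for \<omega>
  proof -
    define x where "x = V \<omega>"
    have uc: "u \<omega> \<in> carrier_vec n" using u \<omega> by (simp add: mvnormal_def)
    have ux: "u \<omega> = \<sigma> \<cdot>\<^sub>v vec n x"
      using uc \<sigma> by (intro eq_vecI) (auto simp: x_def V_def)
    define s where "s = \<sigma> * xi X i * \<eta>"
    have s: "0 < s" using \<sigma> xi(2) \<eta> by (simp add: s_def)
    have Wu: "W *\<^sub>v u \<omega> = \<sigma> \<cdot>\<^sub>v (W *\<^sub>v vec n x)"
      unfolding ux using W_carrier by (intro mult_mat_vec) auto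
    have Wx: "W *\<^sub>v vec n x \<in> carrier_vec k" using W_carrier by simp
    have "(W *\<^sub>v vec n x) $ i = (\<Sum>j<n. W $$ (i, j) * x j)"
      using W_carrier i by (auto simp: scalar_prod_def atLeast0LessThan intro!: sum.cong)
    also have "\<dots> = xi X i * \<eta> * z x"
      using xi(2) \<eta> by (simp add: z_def sum_distrib_left)
    finally have "theta_LS X (X *\<^sub>v \<theta> + u \<omega>) $ i = \<theta> $ i + s * z x"
      unfolding theta_LS_eq[OF \<theta> uc] Wu
      using \<theta> i carrier_matD[OF W_carrier] by (simp add: s_def del: index_mult_mat_vec)
    then have LS: "theta_LS X (X *\<^sub>v \<theta> + u \<omega>) $ i = s * (\<theta> $ i / s + z x)"
      using s by (simp add: distrib_left)
    have "u \<omega> - X *\<^sub>v (W *\<^sub>v u \<omega>) = \<sigma> \<cdot>\<^sub>v (vec n x - X *\<^sub>v (W *\<^sub>v vec n x))"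
      unfolding Wu mult_mat_vec[OF X Wx] unfolding ux
      using X by (intro eq_vecI) (auto simp: right_diff_distrib)
    then have "(u \<omega> - X *\<^sub>v (W *\<^sub>v u \<omega>)) \<bullet> (u \<omega> - X *\<^sub>v (W *\<^sub>v u \<omega>)) = \<sigma>\<^sup>2 * rss x"
      using X Wx by (simp add: rss_def power2_eq_square)
    then have "sigma_hat X (X *\<^sub>v \<theta> + u \<omega>) = sqrt (\<sigma>\<^sup>2 * (rss x / (n - k)))"
      unfolding sigma_hat_def residual_eq[OF \<theta> uc] using X k by (simp add: of_nat_diff)
    also have "\<dots> = \<sigma> * r x"
      using \<sigma> by (simp add: r_def real_sqrt_mult real_sqrt_divide)
    finally have sh: "sigma_hat X (X *\<^sub>v \<theta> + u \<omega>) * xi X i * \<eta> = s * r x"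
      by (simp add: s_def)
    let ?w = "\<theta> $ i / s + z x"
    have max_s: "max (s * a) 0 = s * max a 0" for a :: real
      using s by (simp add: max_def mult_le_0_iff)
    have "theta_soft X \<eta> i (X *\<^sub>v \<theta> + u \<omega>) = sgn (s * ?w) * max (\<bar>s * ?w\<bar> - s * r x) 0"
      unfolding theta_soft_def LS sh ..
    also have "\<dots> = sgn ?w * max (s * (\<bar>?w\<bar> - r x)) 0"
      using s by (simp add: sgn_mult abs_mult right_diff_distrib)
    also have "\<dots> = s * (sgn ?w * max (\<bar>?w\<bar> - r x) 0)"
      unfolding max_s by simp
    also have "\<dots> = s * (?w + shrink (ereal ?w) (r x))"
      using rss_nonneg by (subst soft_threshold_eq_shrink) (auto simp: r_def)
    finally have diff: "theta_soft X \<eta> i (X *\<^sub>v \<theta> + u \<omega>) - \<theta> $ i = s * (z x + shrink (ereal ?w) (r x))"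
      using s by (simp add: distrib_left)
    have inv: "inverse \<sigma> * inverse (xi X i * \<eta>) = inverse s" by (simp add: s_def)
    show ?thesis
      unfolding comp_def x_def[symmetric] s_def[symmetric] diff inv using s by simp
  qed
  show ?thesis
    by (intro exI[of _ "z \<circ> V"] exI[of _ "r \<circ> V"] conjI allI impI ballI)
      (rule meas nonneg law tail rep, assumption?)+
qed

end

section \<open>Asymptotics of the soft-thresholding estimator\<close>

theorem theorem37:
  fixes n0 :: nat and i :: nat
    and k :: "nat \<Rightarrow> nat"
    and X :: "nat \<Rightarrow> real mat"
    and \<eta> :: "nat \<Rightarrow> nat \<Rightarrow> real"
    and \<theta> :: "nat \<Rightarrow> real vec"
    and \<sigma> :: "nat \<Rightarrow> real"
    and M :: "nat \<Rightarrow> 'w measure"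
    and u Y :: "nat \<Rightarrow> 'w \<Rightarrow> real vec"
    and \<zeta> :: ereal
    and \<alpha> :: "nat \<Rightarrow> real"
    and H :: "nat \<Rightarrow> real \<Rightarrow> real"
  assumes k: "\<And>n. n \<ge> n0 \<Longrightarrow> 1 \<le> k n \<and> k n < n"
    and X: "\<And>n. n \<ge> n0 \<Longrightarrow> X n \<in> carrier_mat n (k n) \<and> vec_space.rank n (X n) = k n"
    and \<eta>_pos: "\<And>n j. n \<ge> n0 \<Longrightarrow> j < k n \<Longrightarrow> 0 < \<eta> j n"
    and \<theta>: "\<And>n. n \<ge> n0 \<Longrightarrow> \<theta> n \<in> carrier_vec (k n)"
    and \<sigma>: "\<And>n. n \<ge> n0 \<Longrightarrow> 0 < \<sigma> n"
    and M: "\<And>n. n \<ge> n0 \<Longrightarrow> prob_space (M n)"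
    and u: "\<And>n. n \<ge> n0 \<Longrightarrow> mvnormal (M n) (u n) (0\<^sub>v n) ((\<sigma> n)\<^sup>2 \<cdot>\<^sub>m 1\<^sub>m n)"
    and Y: "\<And>n \<omega>. n \<ge> n0 \<Longrightarrow> \<omega> \<in> space (M n) \<Longrightarrow> Y n \<omega> = X n *\<^sub>v \<theta> n + u n \<omega>"
    and standing: "\<And>j. eventually (\<lambda>n. j < k n) sequentially \<Longrightarrow>
          bdd_above ((\<lambda>n. (xi (X n) j)\<^sup>2 / real n) ` {n. n \<ge> n0 \<and> j < k n})"
    and i: "eventually (\<lambda>n. i < k n) sequentially"
    and xi_eta: "(\<lambda>n. xi (X n) i * \<eta> i n) \<longlonglongrightarrow> 0"
    and sqrt_eta: "filterlim (\<lambda>n. sqrt (real n) * \<eta> i n) at_top sequentially"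
    and \<zeta>: "(\<lambda>n. ereal (\<theta> n $ i / (\<sigma> n * xi (X n) i * \<eta> i n))) \<longlonglongrightarrow> \<zeta>"
    and \<alpha>_def: "\<And>n. \<alpha> n = inverse (xi (X n) i * \<eta> i n)"
    and H_def: "\<And>n. H n = cdf (distr (M n) borel
          (\<lambda>\<omega>. inverse (\<sigma> n) * \<alpha> n * (theta_soft (X n) (\<eta> i n) i (Y n \<omega>) - \<theta> n $ i)))"
  shows "(\<forall>m. eventually (\<lambda>n. n - k n = m) sequentially \<longrightarrow>
            real_distribution (soft_limit m \<zeta>) \<and>
            weak_conv H (cdf (soft_limit m \<zeta>)) \<and>
            soft_limit m \<zeta> =
              atom_plus_density
                (emeasure (chi_square m) {x. ereal x > ereal (real m) * \<zeta>\<^sup>2})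
                (real_of_ereal (- \<zeta>)) (soft_ac_part m \<zeta>) \<and>
            (\<bar>\<zeta>\<bar> = \<infinity> \<longrightarrow>
              soft_limit m \<zeta> =
                density lborel (\<lambda>x. ennreal (rho m (- real_of_ereal (sgn \<zeta>) * x)))))
       \<and> (filterlim (\<lambda>n. n - k n) at_top sequentially \<longrightarrow>
            weak_conv H (cdf (return borel (real_of_ereal (- sgn \<zeta> * min 1 \<bar>\<zeta>\<bar>)))))"
proof -
  define good where "good n \<longleftrightarrow> n0 \<le> n \<and> i < k n" for n
  have good: "eventually good sequentially"
    using i eventually_ge_at_top[of n0] unfolding good_def by eventually_elim simp
  define t where "t n = \<theta> n $ i / (\<sigma> n * xi (X n) i * \<eta> i n)" for n
  define A where "A n \<omega> = inverse (\<sigma> n) * \<alpha> n * (theta_soft (X n) (\<eta> i n) i (Y n \<omega>) - \<theta> n $ i)" for n \<omega>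
  define rep where "rep n Z R \<longleftrightarrow> Z \<in> borel_measurable (M n) \<and> R \<in> borel_measurable (M n) \<and>
      (\<forall>\<omega>\<in>space (M n). 0 \<le> R \<omega>) \<and> distr (M n) borel R = chi_law (n - k n) \<and>
      (\<forall>e>0. measure (M n) {\<omega> \<in> space (M n). e \<le> \<bar>Z \<omega>\<bar>} \<le> 1 / (sqrt n * \<eta> i n * e)\<^sup>2) \<and>
      (\<forall>\<omega>\<in>space (M n). A n \<omega> = Z \<omega> + shrink (ereal (t n + Z \<omega>)) (R \<omega>))" for n Z R
  have "\<exists>Z R. rep n Z R" if "good n" for n
  proof -
    have n: "n0 \<le> n" "i < k n" using that by (auto simp: good_def)
    interpret full_rank_design "X n" n "k n"
      using k[OF n(1)] X[OF n(1)] by unfold_locales auto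
    show ?thesis
      using scaled_error_representation[OF n(2) \<eta>_pos[OF n] \<theta>[OF n(1)] \<sigma>[OF n(1)] M[OF n(1)] u[OF n(1)]]
        Y[OF n(1)]
      by (simp add: rep_def A_def t_def \<alpha>_def)
  qed
  then obtain Z R where ZR: "\<And>n. good n \<Longrightarrow> rep n (Z n) (R n)" by metis
  interpret thresholded_sequence M Z R "\<lambda>n. n - k n" t \<zeta> A
  proof
    show "eventually (\<lambda>n. prob_space (M n)) sequentially"
      using good by eventually_elim (simp add: M good_def)
    show "eventually (\<lambda>n. 0 < n - k n) sequentially"
      using good by eventually_elim (use k in \<open>auto simp: good_def\<close>)
    show "(\<lambda>n. ereal (t n)) \<longlonglongrightarrow> \<zeta>" using \<zeta> by (simp add: t_def)
    fix e :: real assume e: "0 < e"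
    have "filterlim (\<lambda>n. sqrt n * \<eta> i n * e) at_top sequentially"
      by (rule filterlim_at_top_mult_tendsto_pos[OF tendsto_const e sqrt_eta])
    moreover have "(inverse y)\<^sup>2 = 1 / y\<^sup>2" for y :: real
      by (simp add: power_one_over inverse_eq_divide)
    ultimately have "(\<lambda>n. 1 / (sqrt n * \<eta> i n * e)\<^sup>2) \<longlonglongrightarrow> 0"
      using tendsto_power[OF tendsto_inverse_0_at_top, of "\<lambda>n. sqrt n * \<eta> i n * e" sequentially 2]
      by (simp only: zero_power2)
    then show "(\<lambda>n. measure (M n) {\<omega> \<in> space (M n). e \<le> \<bar>Z n \<omega>\<bar>}) \<longlonglongrightarrow> 0"
    proof (rule Lim_null_comparison[rotated])
      show "eventually (\<lambda>n. norm (measure (M n) {\<omega> \<in> space (M n). e \<le> \<bar>Z n \<omega>\<bar>})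
          \<le> 1 / (sqrt n * \<eta> i n * e)\<^sup>2) sequentially"
        using good by eventually_elim (use ZR e in \<open>simp add: rep_def\<close>)
    qed
  next
    show "eventually (\<lambda>n. Z n \<in> borel_measurable (M n)) sequentially"
      "eventually (\<lambda>n. R n \<in> borel_measurable (M n)) sequentially"
      "eventually (\<lambda>n. \<forall>\<omega>\<in>space (M n). 0 \<le> R n \<omega>) sequentially"
      "eventually (\<lambda>n. distr (M n) borel (R n) = chi_law (n - k n)) sequentially"
      "eventually (\<lambda>n. \<forall>\<omega>\<in>space (M n). A n \<omega> = Z n \<omega> + shrink (ereal (t n + Z n \<omega>)) (R n \<omega>)) sequentially"
      by (rule eventually_mono[OF good], drule ZR, unfold rep_def, elim conjE, assumption)+
  qed
  have H: "eventually (\<lambda>n. H n = cdf (distr (M n) borel (A n))) sequentially"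
    by (simp add: H_def A_def[abs_def])
  show ?thesis
  proof (intro conjI allI impI)
    fix m assume m: "eventually (\<lambda>n. n - k n = m) sequentially"
    have "eventually (\<lambda>n. 0 < m) sequentially"
      using m good by eventually_elim (use k in \<open>auto simp: good_def\<close>)
    then have m0: "0 < m" by simp
    show "real_distribution (soft_limit m \<zeta>)"
      unfolding soft_limit_eq_shrink_law[OF m0] by (rule real_distribution_shrink_law)
    show "weak_conv H (cdf (soft_limit m \<zeta>))"
      unfolding soft_limit_eq_shrink_law[OF m0] by (rule weak_conv_fixed_df[OF m H])
    show "soft_limit m \<zeta> = atom_plus_density
        (emeasure (chi_square m) {x. ereal x > ereal (real m) * \<zeta>\<^sup>2})
        (real_of_ereal (- \<zeta>)) (soft_ac_part m \<zeta>)"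
      unfolding soft_limit_def soft_limit_atom_weight[OF m0] ..
    show "soft_limit m \<zeta> = density lborel (\<lambda>x. ennreal (rho m (- real_of_ereal (sgn \<zeta>) * x)))"
      if "\<bar>\<zeta>\<bar> = \<infinity>"
      using soft_limit_infinite[OF m0 that] .
  next
    assume "filterlim (\<lambda>n. n - k n) at_top sequentially"
    then show "weak_conv H (cdf (return borel (real_of_ereal (- sgn \<zeta> * min 1 \<bar>\<zeta>\<bar>))))"
      unfolding shrink_one[symmetric] by (rule weak_conv_diverging_df[OF _ H])
  qed
qed

end
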